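(* Let $r,n_1,\ldots,n_r,M,N$ be positive integers, let $n=n_1+\cdots+n_r$, let $X$ be the $M\times N$ random matrix with entries $\frac{1}{\sqrt N}f_{ij}$, where the $f_{ij}$ are independent real $N(0,1)$ random variables, and let $D_1,\ldots,D_{2n}$ be arbitrary constant matrices, with $D_m$ of size $M\times M$ for $m$ odd and of size $N\times N$ for $m$ even. With $Y_1,\ldots,Y_r$, the permutations $\gamma,\gamma_+,\gamma_-,\hat\pi$ and the notation $\gamma_-^{-1}\hat\pi\gamma_+/2$ and $\mathrm{Tr}_\sigma$ as defined in the context, the $r$th cumulant of $Y_1,\ldots,Y_r$ is $$k_r(Y_1,\ldots,Y_r)=N^{-n-r}\sum_{\substack{\pi\in\mathcal{P}_2(2n)\\ \langle\gamma,\pi\rangle\text{ acts transitively on }[2n]}}\mathrm{Tr}_{\gamma_-^{-1}\hat\pi\gamma_+/2}(D_1,\ldots,D_{2n}).$$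
   Context: Notation: $[m]=\{1,\ldots,m\}$ and $[\pm m]=\{1,\ldots,m\}\cup\{-1,\ldots,-m\}$. $\mathrm{Tr}$ is the usual trace and $\mathrm{tr}:=\frac1N\mathrm{Tr}$ (always normalised by $N$). Matrices have real entries. Put $s_0=0$ and $s_k=n_1+\cdots+n_k$. For $1\le k\le r$, $$Y_k:=\mathrm{tr}\left(X^TD_{2s_{k-1}+1}XD_{2s_{k-1}+2}X^TD_{2s_{k-1}+3}XD_{2s_{k-1}+4}\cdots X^TD_{2s_k-1}XD_{2s_k}\right).$$ Cumulants: $k_1,k_2,\ldots$ are the functions, $k_m$ being $m$-linear in random variables (having all moments), determined by the moment-cumulant formula $$\mathbb{E}(X_1\cdots X_m)=\sum_{\rho\in\mathcal{P}(m)}\ \prod_{\{i_1,\ldots,i_l\}\in\rho}k_l(X_{i_1},\ldots,X_{i_l})$$ for all $m$ and all $X_1,\ldots,X_m$, where $\mathcal{P}(m)$ is the set of partitions of $[m]$. $\mathcal{P}_2(2n)$ is the set of pairings of $[2n]$, i.e. partitions of $[2n]$ into blocks of exactly two elements. A pairing $\pi$ is identified with the permutation of $[2n]$ that swaps the two elements of each block; it is viewed as a permutation of $[\pm 2n]$ by letting it fix every negative integer. $\gamma$ is the permutation of $[2n]$ with cycles $(2s_{k-1}+1,2s_{k-1}+2,\ldots,2s_k)$, $1\le k\le r$, and $\langle\gamma,\pi\rangle$ is the subgroup of $S_{2n}$ generated by $\gamma$ and $\pi$. Permutations of $[\pm2n]$ (composed right to left): $\delta(k)=-k$; $\delta'(k)=-k$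 if $|k|$ is odd and $\delta'(k)=k$ if $|k|$ is even (the odd positions are those where $X$ appears transposed); $\hat\pi:=\delta'\pi\delta\pi\delta'$; $\gamma_+$ is the permutation equal to $\gamma$ on $[2n]$ and fixing every negative integer; $\gamma_-$ is the permutation whose cycles on the negative integers are $(-(2s_{k-1}+1),-(2s_{k-1}+2),\ldots,-2s_k)$ for $1\le k\le r$ and which fixes every positive integer. The cycles of $\gamma_-^{-1}\hat\pi\gamma_+$ come in pairs of distinct cycles $(k_1,\ldots,k_m)$ and $(-k_m,\ldots,-k_1)$. A cycle is called particular if its element of lowest absolute value is positive. $\gamma_-^{-1}\hat\pi\gamma_+/2$ denotes the permutation consisting of the particular cycles of $\gamma_-^{-1}\hat\pi\gamma_+$ (including fixed points), acting on the set of integers appearing in these cycles. For a permutation $\sigma$ of a subset of $[\pm m]$ and matrices $A_1,\ldots,A_m$, write $A_k^{(1)}=A_k$ and $A_k^{(-1)}=A_k^T$, and define $$\mathrm{Tr}_\sigma(A_1,\ldots,A_m):=\prod_{(c_1,\ldots,c_l)}\mathrm{Tr}\left(A_{|c_1|}^{(\mathrm{sgn}(c_1))}\cdots A_{|c_l|}^{(\mathrm{sgn}(c_l))}\right),$$ the product being over all cycles $(c_1,\ldots,c_l)$ of $\sigma$, including fixed points. *)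

theory Defs
  imports
    "HOL-Probability.Probability"
    "HOL-Combinatorics.Cycles"
    "HOL-Combinatorics.Orbits"
    "HOL-Algebra.Sym_Groups"
    "Jordan_Normal_Form.Matrix"
begin

subsection \<open>Cumulants\<close>

text \<open>
  The cumulant \<open>k\<^sub>l(X\<^sub>i\<^sub>1, \<dots>, X\<^sub>i\<^sub>l)\<close> is written \<open>cumulant P X {i\<^sub>1, \<dots>, i\<^sub>l}\<close>.  The recursion is the
  moment-cumulant formula solved for the term of the one-block partition; see
  \<open>moment_cumulant\<close> and \<open>cumulant_unique\<close> below.
\<close>

function cumulant :: "'a measure \<Rightarrow> ('i \<Rightarrow> 'a \<Rightarrow> real) \<Rightarrow> 'i set \<Rightarrow> real" where
  "cumulant P X I =
     (if finite I
      then (\<integral>\<omega>. (\<Prod>i\<in>I. X i \<omega>) \<partial>P)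
           - (\<Sum>\<rho>\<in>{\<rho>. partition_on I \<rho> \<and> \<rho> \<noteq> {I}}. \<Prod>B\<in>\<rho>. cumulant P X B)
      else 0)"
  by pat_completeness auto

lemma proper_block_psubset:
  assumes "partition_on I \<rho>" "\<rho> \<noteq> {I}" "B \<in> \<rho>"
  shows "B \<subset> I"
proof -
  have sub: "B \<subseteq> I" using assms(1,3) by (auto simp: partition_on_def)
  have "B \<noteq> I"
  proof
    assume "B = I"
    have "C = I" if "C \<in> \<rho>" for C
    proof (rule ccontr)
      assume "C \<noteq> I"
      then have "C \<inter> I = {}"
        using assms(1,3) that \<open>B = I\<close> by (auto simp: partition_on_def disjoint_def)
      moreover have "C \<subseteq> I" "C \<noteq> {}" using assms(1) that by (auto simp: partition_on_def)
      ultimately show False by auto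
    qed
    then have "\<rho> = {I}" using assms(3) \<open>B = I\<close> by blast
    then show False using assms(2) by contradiction
  qed
  with sub show ?thesis by auto
qed

termination cumulant
proof (relation "Wellfounded.measure (\<lambda>(P, X, I). card I)")
  fix P :: "'a measure" and X :: "'i \<Rightarrow> 'a \<Rightarrow> real" and I B :: "'i set" and \<rho>
  assume "finite I" "\<rho> \<in> {\<rho>. partition_on I \<rho> \<and> \<rho> \<noteq> {I}}" "B \<in> \<rho>"
  then have "card B < card I"
    by (intro psubset_card_mono) (assumption, rule proper_block_psubset, simp_all)
  then show "((P, X, B), (P, X, I)) \<in> Wellfounded.measure (\<lambda>(P, X, I). card I)" by simp
qed simp

declare cumulant.simps [simp del]

lemma moment_cumulant:
  assumes "finite I" "I \<noteq> {}"
  shows "(\<integral>\<omega>. (\<Prod>i\<in>I. X i \<omega>) \<partial>P) = (\<Sum>\<rho> | partition_on I \<rho>. \<Prod>B\<in>\<rho>. cumulant P X B)"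
proof -
  have fin: "finite {\<rho>. partition_on I \<rho>}"
    using finitely_many_partition_on[OF assms(1)] by simp
  have "{I} \<in> {\<rho>. partition_on I \<rho>}"
    using assms(2) by (auto simp: partition_on_def)
  then have "(\<Sum>\<rho> | partition_on I \<rho>. \<Prod>B\<in>\<rho>. cumulant P X B)
      = cumulant P X I + (\<Sum>\<rho>\<in>{\<rho>. partition_on I \<rho>} - {{I}}. \<Prod>B\<in>\<rho>. cumulant P X B)"
    using fin by (subst sum.remove[of _ "{I}"]) auto
  moreover have "{\<rho>. partition_on I \<rho>} - {{I}} = {\<rho>. partition_on I \<rho> \<and> \<rho> \<noteq> {I}}" by auto
  moreover have "cumulant P X I = (\<integral>\<omega>. (\<Prod>i\<in>I. X i \<omega>) \<partial>P)
      - (\<Sum>\<rho>\<in>{\<rho>. partition_on I \<rho> \<and> \<rho> \<noteq> {I}}. \<Prod>B\<in>\<rho>. cumulant P X B)"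
    using assms(1) cumulant.simps[of P X I] by (simp only: if_True)
  ultimately show ?thesis by simp
qed

lemma cumulant_unique:
  assumes "finite I" "I \<noteq> {}"
    and "\<And>J. J \<subseteq> I \<Longrightarrow> J \<noteq> {} \<Longrightarrow>
      (\<integral>\<omega>. (\<Prod>i\<in>J. X i \<omega>) \<partial>P) = (\<Sum>\<rho> | partition_on J \<rho>. \<Prod>B\<in>\<rho>. \<kappa> B)"
  shows "\<kappa> I = cumulant P X I"
  using assms
proof (induction I rule: finite_psubset_induct)
  case (psubset I)
  have fin: "finite {\<rho>. partition_on I \<rho>}"
    using finitely_many_partition_on[OF psubset.hyps] by simp
  have one: "{I} \<in> {\<rho>. partition_on I \<rho>}"
    using psubset.prems(1) by (auto simp: partition_on_def)
  have IH: "\<kappa> B = cumulant P X B" if "partition_on I \<rho>" "\<rho> \<noteq> {I}" "B \<in> \<rho>" for \<rho> B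
  proof (rule psubset.IH)
    show BI: "B \<subset> I" using that by (rule proper_block_psubset)
    show "B \<noteq> {}" using that by (auto simp: partition_on_def)
    show "(\<integral>\<omega>. (\<Prod>i\<in>J. X i \<omega>) \<partial>P) = (\<Sum>\<rho> | partition_on J \<rho>. \<Prod>B\<in>\<rho>. \<kappa> B)"
      if "J \<subseteq> B" "J \<noteq> {}" for J
      using psubset.prems(2) that BI by blast
  qed
  have "\<kappa> I + (\<Sum>\<rho>\<in>{\<rho>. partition_on I \<rho>} - {{I}}. \<Prod>B\<in>\<rho>. \<kappa> B)
      = (\<Sum>\<rho> | partition_on I \<rho>. \<Prod>B\<in>\<rho>. \<kappa> B)"
    using fin one by (subst sum.remove[of _ "{I}"]) auto
  also have "\<dots> = (\<Sum>\<rho> | partition_on I \<rho>. \<Prod>B\<in>\<rho>. cumulant P X B)"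
    using psubset.prems(2)[of I] psubset.prems(1) moment_cumulant[OF psubset.hyps psubset.prems(1), where P = P and X = X]
    by simp
  also have "\<dots> = cumulant P X I + (\<Sum>\<rho>\<in>{\<rho>. partition_on I \<rho>} - {{I}}. \<Prod>B\<in>\<rho>. cumulant P X B)"
    using fin one by (subst sum.remove[of _ "{I}"]) auto
  also have "(\<Sum>\<rho>\<in>{\<rho>. partition_on I \<rho>} - {{I}}. \<Prod>B\<in>\<rho>. cumulant P X B)
      = (\<Sum>\<rho>\<in>{\<rho>. partition_on I \<rho>} - {{I}}. \<Prod>B\<in>\<rho>. \<kappa> B)"
    by (rule sum.cong[OF refl], rule prod.cong[OF refl], rule IH[symmetric]) simp_all
  finally show ?case by simp
qed


subsection \<open>Products and traces of matrices\<close>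

text \<open>
  The dimensions of a word of matrices are not known in advance, so its product starts from the
  first factor instead of an identity matrix; the empty word does not occur.
\<close>

fun mat_prod :: "real mat list \<Rightarrow> real mat" where
  "mat_prod [] = 1\<^sub>m 0"
| "mat_prod [A] = A"
| "mat_prod (A # B # As) = A * mat_prod (B # As)"

definition mat_trace :: "real mat \<Rightarrow> real" where
  "mat_trace A = (\<Sum>i<dim_row A. A $$ (i, i))"

definition gaussian_matrix :: "nat \<Rightarrow> nat \<Rightarrow> (nat \<Rightarrow> nat \<Rightarrow> 'a \<Rightarrow> real) \<Rightarrow> 'a \<Rightarrow> real mat" where
  "gaussian_matrix M N f \<omega> = mat M N (\<lambda>(i, j). f i j \<omega> / sqrt (real N))"

definition psum :: "(nat \<Rightarrow> nat) \<Rightarrow> nat \<Rightarrow> nat" where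
  "psum ns k = (\<Sum>i=1..k. ns i)"

definition Y_word :: "(nat \<Rightarrow> nat) \<Rightarrow> real mat \<Rightarrow> (nat \<Rightarrow> real mat) \<Rightarrow> nat \<Rightarrow> real mat list" where
  "Y_word ns X D k =
     concat (map (\<lambda>j. [transpose_mat X, D (2 * j + 1), X, D (2 * j + 2)])
                 [psum ns (k - 1) ..< psum ns k])"

definition Y :: "nat \<Rightarrow> nat \<Rightarrow> (nat \<Rightarrow> nat \<Rightarrow> 'a \<Rightarrow> real) \<Rightarrow> (nat \<Rightarrow> nat) \<Rightarrow> (nat \<Rightarrow> real mat)
    \<Rightarrow> nat \<Rightarrow> 'a \<Rightarrow> real" where
  "Y M N f ns D k \<omega> =
     mat_trace (mat_prod (Y_word ns (gaussian_matrix M N f \<omega>) D k)) / real N"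


subsection \<open>Permutations\<close>

text \<open>
  Permutations of \<open>{1..2n}\<close> are functions on \<^typ>\<open>nat\<close>, and those of
  \<open>{1..2n} \<union> {-2n..-1}\<close> are functions on \<^typ>\<open>int\<close>.  The values of the latter
  outside that set are irrelevant, since only orbits of its elements are used.
\<close>

definition prod_of_cycles :: "'a list list \<Rightarrow> 'a \<Rightarrow> 'a" where
  "prod_of_cycles css = foldr (\<circ>) (map cycle_of_list css) id"

definition interval_cycle :: "(nat \<Rightarrow> nat) \<Rightarrow> nat \<Rightarrow> nat list" where
  "interval_cycle ns k = [2 * psum ns (k - 1) + 1 ..< Suc (2 * psum ns k)]"

definition gamma :: "nat \<Rightarrow> (nat \<Rightarrow> nat) \<Rightarrow> nat \<Rightarrow> nat" where
  "gamma r ns = prod_of_cycles (map (interval_cycle ns) [1..<Suc r])"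

definition signed_interval :: "nat \<Rightarrow> int set" where
  "signed_interval m = {k. 1 \<le> \<bar>k\<bar> \<and> \<bar>k\<bar> \<le> int m}"

definition extend_pos :: "(nat \<Rightarrow> nat) \<Rightarrow> int \<Rightarrow> int" where
  "extend_pos \<sigma> k = (if k > 0 then int (\<sigma> (nat k)) else k)"

definition gamma_plus :: "nat \<Rightarrow> (nat \<Rightarrow> nat) \<Rightarrow> int \<Rightarrow> int" where
  "gamma_plus r ns = extend_pos (gamma r ns)"

definition gamma_minus :: "nat \<Rightarrow> (nat \<Rightarrow> nat) \<Rightarrow> int \<Rightarrow> int" where
  "gamma_minus r ns =
     prod_of_cycles (map (\<lambda>k. map (\<lambda>j. - int j) (interval_cycle ns k)) [1..<Suc r])"

definition delta :: "int \<Rightarrow> int" where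
  "delta k = - k"

definition delta' :: "int \<Rightarrow> int" where
  "delta' k = (if odd k then - k else k)"

definition pairings :: "nat \<Rightarrow> nat set set set" where
  "pairings m = {\<pi>. partition_on {1..m} \<pi> \<and> (\<forall>b\<in>\<pi>. card b = 2)}"

definition pairing_perm :: "nat set set \<Rightarrow> nat \<Rightarrow> nat" where
  "pairing_perm \<pi> k = (if k \<in> \<Union>\<pi> then THE l. l \<noteq> k \<and> {k, l} \<in> \<pi> else k)"

definition pi_hat :: "nat set set \<Rightarrow> int \<Rightarrow> int" where
  "pi_hat \<pi> = delta' \<circ> extend_pos (pairing_perm \<pi>) \<circ> delta \<circ> extend_pos (pairing_perm \<pi>) \<circ> delta'"

definition acts_transitively_on :: "('a \<Rightarrow> 'a) set \<Rightarrow> 'a set \<Rightarrow> bool" where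
  "acts_transitively_on G A \<longleftrightarrow> (\<forall>x\<in>A. \<forall>y\<in>A. \<exists>g\<in>G. g x = y)"

definition gamma_hat :: "nat \<Rightarrow> (nat \<Rightarrow> nat) \<Rightarrow> nat set set \<Rightarrow> int \<Rightarrow> int" where
  "gamma_hat r ns \<pi> = inv_into UNIV (gamma_minus r ns) \<circ> pi_hat \<pi> \<circ> gamma_plus r ns"

text \<open>
  For a permutation \<open>\<sigma>\<close> of \<open>S\<close>, the elements of \<open>S\<close> lying on particular cycles; the permutation
  \<open>\<sigma>/2\<close> is the restriction of \<open>\<sigma>\<close> to this set.
\<close>

definition half_domain :: "(int \<Rightarrow> int) \<Rightarrow> int set \<Rightarrow> int set" where
  "half_domain \<sigma> S =
     {x \<in> S. \<exists>y\<in>Orbits.orbit \<sigma> x. y > 0 \<and> (\<forall>z\<in>Orbits.orbit \<sigma> x. \<bar>y\<bar> \<le> \<bar>z\<bar>)}"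

definition half :: "(int \<Rightarrow> int) \<Rightarrow> int set \<Rightarrow> int \<Rightarrow> int" where
  "half \<sigma> S = perm_restrict \<sigma> (half_domain \<sigma> S)"

definition signed_mat :: "(nat \<Rightarrow> real mat) \<Rightarrow> int \<Rightarrow> real mat" where
  "signed_mat A k = (if k > 0 then A (nat k) else transpose_mat (A (nat (- k))))"

text \<open>
  \<open>Tr\<^sub>\<sigma>\<close> for a permutation \<open>\<sigma>\<close> of the finite set \<open>S\<close>.  The set is an argument because fixed points
  count as cycles.  Each cycle is written out from its least element; by cyclicity of the trace
  the starting point does not matter.
\<close>

definition Tr_perm :: "int set \<Rightarrow> (int \<Rightarrow> int) \<Rightarrow> (nat \<Rightarrow> real mat) \<Rightarrow> real" where
  "Tr_perm S \<sigma> A =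
     (\<Prod>C\<in>Orbits.orbit \<sigma> ` S. mat_trace (mat_prod (map (signed_mat A) (Cycles.support \<sigma> (Min C)))))"

end

theory Submission
  imports Defs
begin

text \<open>
  The entries of \<open>X\<close> are jointly Gaussian, so everything reduces to Wick's formula and bookkeeping of
  indices. Write the pair (row, column) of the factor \<open>X\<close> at position \<open>p\<close> as \<open>e p\<close>. Expanding the
  trace turns \<open>Y\<^sub>k\<close> into a sum, over the functions \<open>e\<close> on the \<open>k\<close>th interval of positions, of
  a product of entries of the \<open>D\<^sub>p\<close> times \<open>\<Prod>\<^sub>p f\<^bsub>e p\<^esub>\<close> (\<open>Y_expansion\<close>). The expectation of a
  product \<open>\<Prod>\<^sub>p f\<^bsub>e p\<^esub>\<close> is the number of pairings of the positions on whose blocks \<open>e\<close> is constant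
  (\<open>wick\<close>).

  A pairing joins two intervals whenever one of its blocks meets both. Sorting the pairings by the
  partition of the intervals into connected components gives the moment-cumulant formula with the
  connected pairings in the role of the cumulants (\<open>sum_pairings_eq_sum_connected\<close>,
  \<open>cumulant_gaussian_forms\<close>). Since the cycles of \<open>\<gamma>\<close> are the intervals, a pairing \<open>\<pi>\<close> is connected
  exactly if \<open>\<langle>\<gamma>, \<pi>\<rangle>\<close> is transitive (\<open>transitive_iff_connected_via\<close>).

  For a fixed pairing there remains a sum over the functions \<open>e\<close> that are constant on the blocks.
  Each such function amounts to a choice of one index for every pair of matrix indices that \<open>\<pi>\<close>
  identifies. Following these identifications from matrix to matrix, where a matrix entered through
  its column is read as its transpose, amounts to iterating the permutation
  \<open>gamma_hat\<close> (\<open>gamma_hat_slot\<close>). Every closed walk is met twice, once in each direction; keeping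
  the particular cycles counts it once and leaves a product of traces (\<open>sum_over_half\<close>,
  \<open>sum_matched_eq_Tr_perm\<close>).
\<close>

section \<open>Traces as sums over index functions\<close>

lemma sum_PiE_insert:
  assumes "finite S" "x \<notin> S" "\<And>y. y \<in> insert x S \<Longrightarrow> finite (T y)"
  shows "(\<Sum>i\<in>PiE (insert x S) T. h i) = (\<Sum>u\<in>T x. \<Sum>i\<in>PiE S T. h (i(x := u)))"
proof -
  have "(\<Sum>i\<in>PiE (insert x S) T. h i) = (\<Sum>(u, i)\<in>T x \<times> PiE S T. h (i(x := u)))"
    unfolding PiE_insert_eq
    by (subst sum.reindex[OF inj_combinator[OF assms(2)]]) (simp add: case_prod_unfold)
  then show ?thesis by (simp add: sum.cartesian_product)
qed

text \<open>
  Distributivity for sums over choice functions: a choice function on a disjoint union is a family of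
  choice functions on the parts. All factorisations below (of a product of traces into its factors, of
  the weight of a pairing into its components, of a trace along a permutation into its cycles)
  are instances.
\<close>
lemma sum_PiE_UNION_prod:
  fixes g :: "'i \<Rightarrow> ('a \<Rightarrow> 'b) \<Rightarrow> 'c::comm_semiring_1"
  assumes "finite I" and finA: "\<And>i. i \<in> I \<Longrightarrow> finite (A i)"
    and disj: "\<And>i j. i \<in> I \<Longrightarrow> j \<in> I \<Longrightarrow> i \<noteq> j \<Longrightarrow> A i \<inter> A j = {}"
    and finT: "\<And>x. finite (T x)"
    and local: "\<And>i e. i \<in> I \<Longrightarrow> g i (restrict e (A i)) = g i e"
  shows "(\<Sum>e\<in>PiE (\<Union>i\<in>I. A i) T. \<Prod>i\<in>I. g i e) = (\<Prod>i\<in>I. \<Sum>e\<in>PiE (A i) T. g i e)"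
proof -
  define ix where "ix x = (THE i. i \<in> I \<and> x \<in> A i)" for x
  have ix: "ix x = i" if "i \<in> I" "x \<in> A i" for x i
    unfolding ix_def using that disj by (intro the_equality) blast+
  have "(\<Prod>i\<in>I. \<Sum>e\<in>PiE (A i) T. g i e) = (\<Sum>h\<in>PiE I (\<lambda>i. PiE (A i) T). \<Prod>i\<in>I. g i (h i))"
    using assms by (intro prod_sum_PiE finite_PiE) auto
  also have "\<dots> = (\<Sum>e\<in>PiE (\<Union>i\<in>I. A i) T. \<Prod>i\<in>I. g i e)"
  proof (rule sum.reindex_bij_witness[where
        i = "\<lambda>e. \<lambda>i\<in>I. restrict e (A i)" and j = "\<lambda>h. \<lambda>x\<in>(\<Union>i\<in>I. A i). h (ix x) x"])
    fix h assume h: "h \<in> PiE I (\<lambda>i. PiE (A i) T)"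
    have eq: "restrict (\<lambda>x\<in>(\<Union>i\<in>I. A i). h (ix x) x) (A i) = h i" if "i \<in> I" for i
    proof
      fix x show "restrict (\<lambda>x\<in>(\<Union>i\<in>I. A i). h (ix x) x) (A i) x = h i x"
        using that h ix[OF that, of x] by (cases "x \<in> A i") (auto simp: PiE_def extensional_def Pi_def)
    qed
    show "(\<lambda>i\<in>I. restrict (\<lambda>x\<in>(\<Union>i\<in>I. A i). h (ix x) x) (A i)) = h"
    proof
      fix i show "(\<lambda>i\<in>I. restrict (\<lambda>x\<in>(\<Union>i\<in>I. A i). h (ix x) x) (A i)) i = h i"
      proof (cases "i \<in> I")
        case True
        then show ?thesis using eq[OF True] by (simp only: restrict_apply if_True)
      next
        case False
        then show ?thesis using PiE_arb[OF h False] by (simp only: restrict_apply if_False)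
      qed
    qed
    show "(\<lambda>x\<in>(\<Union>i\<in>I. A i). h (ix x) x) \<in> PiE (\<Union>i\<in>I. A i) T"
      using h ix by (auto simp: PiE_def Pi_def)
    show "(\<Prod>i\<in>I. g i (\<lambda>x\<in>(\<Union>i\<in>I. A i). h (ix x) x)) = (\<Prod>i\<in>I. g i (h i))"
      by (rule prod.cong[OF refl]) (metis eq local)
  next
    fix e assume e: "e \<in> PiE (\<Union>i\<in>I. A i) T"
    show "(\<lambda>x\<in>(\<Union>i\<in>I. A i). (\<lambda>i\<in>I. restrict e (A i)) (ix x) x) = e"
    proof
      fix x show "(\<lambda>x\<in>(\<Union>i\<in>I. A i). (\<lambda>i\<in>I. restrict e (A i)) (ix x) x) x = e x"
      proof (cases "x \<in> (\<Union>i\<in>I. A i)")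
        case True
        then obtain i where i: "i \<in> I" "x \<in> A i" by auto
        then show ?thesis using True ix[OF i] by simp
      next
        case False
        then show ?thesis using PiE_arb[OF e False] by (simp only: restrict_apply if_False)
      qed
    qed
    have "restrict e (A i) \<in> PiE (A i) T" if "i \<in> I" for i
      using PiE_mem[OF e] that by auto
    then show "(\<lambda>i\<in>I. restrict e (A i)) \<in> PiE I (\<lambda>i. PiE (A i) T)" by simp
  qed
  finally show ?thesis ..
qed

fun walk_weight :: "('x \<Rightarrow> real mat) \<Rightarrow> ('x \<Rightarrow> nat) \<Rightarrow> 'x list \<Rightarrow> nat \<Rightarrow> real" where
  "walk_weight A i [] v = 1"
| "walk_weight A i [x] v = A x $$ (i x, v)"
| "walk_weight A i (x # y # ys) v = A x $$ (i x, i y) * walk_weight A i (y # ys) v"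

lemma walk_weight_cong:
  "(\<And>x. x \<in> set xs \<Longrightarrow> i x = i' x) \<Longrightarrow> walk_weight A i xs v = walk_weight A i' xs v"
  by (induction A i xs v rule: walk_weight.induct) auto

lemma walk_weight_conv_prod:
  "walk_weight A i xs v =
    (\<Prod>j<length xs. A (xs ! j) $$ (i (xs ! j), if Suc j < length xs then i (xs ! Suc j) else v))"
proof (induction A i xs v rule: walk_weight.induct)
  case (3 A i x y ys v)
  then show ?case
    by (simp del: prod.lessThan_Suc add: prod.lessThan_Suc_shift cong: if_cong)
qed auto

text \<open>
  Summing over the index between the first two factors adds that index to the index function, so the
  entries of the product are sums over walks with prescribed ends \<open>u\<close> and \<open>v\<close>.
\<close>
lemma mat_prod_entry:
  assumes "distinct (x # ys)"
    and "\<And>j. j < length (x # ys) \<Longrightarrow> A ((x # ys) ! j) \<in>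
      carrier_mat (d ((x # ys) ! j)) (if Suc j < length (x # ys) then d ((x # ys) ! Suc j) else m)"
  shows "mat_prod (map A (x # ys)) \<in> carrier_mat (d x) m \<and>
    (\<forall>u<d x. \<forall>v<m. mat_prod (map A (x # ys)) $$ (u, v) =
      (\<Sum>i\<in>PiE (set ys) (\<lambda>y. {..<d y}). walk_weight A (i(x := u)) (x # ys) v))"
  using assms
proof (induction ys arbitrary: x)
  case Nil
  then show ?case using Nil(2)[of 0] by simp
next
  case (Cons y ys)
  let ?M = "mat_prod (map A (y # ys))"
  have Ax: "A x \<in> carrier_mat (d x) (d y)" using Cons.prems(2)[of 0] by simp
  have IH: "?M \<in> carrier_mat (d y) m"
    "\<And>w v. w < d y \<Longrightarrow> v < m \<Longrightarrow> ?M $$ (w, v) =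
      (\<Sum>i\<in>PiE (set ys) (\<lambda>y. {..<d y}). walk_weight A (i(y := w)) (y # ys) v)"
    using Cons.IH[of y] Cons.prems(1) Cons.prems(2)[of "Suc j" for j] by (simp_all add: fun_upd_def cong: if_cong)
  have "(A x * ?M) $$ (u, v) =
      (\<Sum>i\<in>PiE (set (y # ys)) (\<lambda>y. {..<d y}). walk_weight A (i(x := u)) (x # y # ys) v)"
    if "u < d x" "v < m" for u v
  proof -
    have "(A x * ?M) $$ (u, v) = (\<Sum>w<d y. A x $$ (u, w) * ?M $$ (w, v))"
      using Ax IH(1) that by (simp add: scalar_prod_def atLeast0LessThan)
    also have "\<dots> = (\<Sum>w<d y. \<Sum>i\<in>PiE (set ys) (\<lambda>y. {..<d y}).
        A x $$ (u, w) * walk_weight A (i(y := w)) (y # ys) v)"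
      using IH(2) that by (simp add: sum_distrib_left)
    also have "\<dots> = (\<Sum>w<d y. \<Sum>i\<in>PiE (set ys) (\<lambda>y. {..<d y}).
        walk_weight A (i(y := w, x := u)) (x # y # ys) v)"
    proof (intro sum.cong refl)
      fix w i
      have "walk_weight A (i(y := w)) (y # ys) v = walk_weight A (i(y := w, x := u)) (y # ys) v"
        using Cons.prems(1) by (intro walk_weight_cong) auto
      then show "A x $$ (u, w) * walk_weight A (i(y := w)) (y # ys) v =
          walk_weight A (i(y := w, x := u)) (x # y # ys) v"
        using Cons.prems(1) by auto
    qed
    also have "\<dots> = (\<Sum>i\<in>PiE (set (y # ys)) (\<lambda>y. {..<d y}). walk_weight A (i(x := u)) (x # y # ys) v)"
      using Cons.prems(1) by (simp add: sum_PiE_insert)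
    finally show ?thesis .
  qed
  moreover have "A x * ?M \<in> carrier_mat (d x) m" using Ax IH(1) by simp
  ultimately show ?case by (simp add: fun_upd_def)
qed

text \<open>
  Closing the walk attaches one index to every letter, namely the row index of its matrix. The letters
  are distinct labels instead of matrices, so that the indices form a function on the set of labels.
\<close>
lemma mat_trace_mat_prod:
  assumes "xs \<noteq> []" "distinct xs"
    and nx: "\<And>j. j < length xs \<Longrightarrow> nx (xs ! j) = xs ! (Suc j mod length xs)"
    and car: "\<And>x. x \<in> set xs \<Longrightarrow> A x \<in> carrier_mat (d x) (d (nx x))"
  shows "mat_trace (mat_prod (map A xs)) =
    (\<Sum>i\<in>PiE (set xs) (\<lambda>x. {..<d x}). \<Prod>x\<in>set xs. A x $$ (i x, i (nx x)))"
proof -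
  obtain x ys where xs: "xs = x # ys" using assms(1) by (cases xs) auto
  have nx': "nx (xs ! j) = (if Suc j < length xs then xs ! Suc j else x)" if "j < length xs" for j
    using nx[OF that] that xs by (cases "Suc j = length xs") auto
  have "A (xs ! j) \<in> carrier_mat (d (xs ! j)) (if Suc j < length xs then d (xs ! Suc j) else d x)"
    if "j < length xs" for j
    using car[of "xs ! j"] nx'[OF that] that by (auto split: if_splits)
  note entry = mat_prod_entry[of x ys A d "d x", OF assms(2)[unfolded xs] this[unfolded xs]]
  have "mat_trace (mat_prod (map A xs)) = (\<Sum>u<d x. \<Sum>i\<in>PiE (set ys) (\<lambda>y. {..<d y}).
      walk_weight A (i(x := u)) (x # ys) ((i(x := u)) x))"
    using entry unfolding xs mat_trace_def by auto
  also have "\<dots> = (\<Sum>i\<in>PiE (set xs) (\<lambda>x. {..<d x}). walk_weight A i xs (i x))"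
    using assms(2) unfolding xs by (simp add: sum_PiE_insert)
  also have "\<dots> = (\<Sum>i\<in>PiE (set xs) (\<lambda>x. {..<d x}). \<Prod>x\<in>set xs. A x $$ (i x, i (nx x)))"
  proof (rule sum.cong[OF refl])
    fix i
    have "(\<Prod>x\<in>set xs. A x $$ (i x, i (nx x))) = (\<Prod>j<length xs. A (xs ! j) $$ (i (xs ! j), i (nx (xs ! j))))"
      using assms(2) by (intro prod.reindex_bij_betw[symmetric] bij_betw_nth) auto
    then show "walk_weight A i xs (i x) = (\<Prod>x\<in>set xs. A x $$ (i x, i (nx x)))"
      unfolding walk_weight_conv_prod by (auto simp: nx' intro!: prod.cong)
  qed
  finally show ?thesis .
qed

section \<open>Wick's formula\<close>

definition pairings_on :: "'a set \<Rightarrow> 'a set set set" where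
  "pairings_on A = {\<pi>. partition_on A \<pi> \<and> (\<forall>b\<in>\<pi>. card b = 2)}"

definition matched :: "('a \<Rightarrow> 'b) \<Rightarrow> 'a set \<Rightarrow> real" where
  "matched e b = of_bool (\<forall>x\<in>b. \<forall>y\<in>b. e x = e y)"

lemma finite_pairings_on: "finite A \<Longrightarrow> finite (pairings_on A)"
  using finitely_many_partition_on[of A] by (rule finite_subset[rotated]) (auto simp: pairings_on_def)

lemma finite_pairing:
  assumes "finite A" "\<pi> \<in> pairings_on A"
  shows "finite \<pi>"
  using assms finite_elements by (auto simp: pairings_on_def)

text \<open>
  A pairing of \<open>A\<close> is a partner \<open>q\<close> of \<open>p\<close> together with a pairing of the rest.
\<close>
lemma sum_pairings_on_remove:
  assumes "finite A" "p \<in> A"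
  shows "(\<Sum>\<pi>\<in>pairings_on A. h \<pi>) =
    (\<Sum>q\<in>A - {p}. \<Sum>\<pi>\<in>pairings_on (A - {p, q}). h (insert {p, q} \<pi>))"
proof -
  define f where "f = (\<lambda>(q, \<pi>). insert {p, q} \<pi>)"
  let ?S = "SIGMA q:A - {p}. pairings_on (A - {p, q})"
  have notin: "p \<notin> \<Union>\<pi>" "q \<notin> \<Union>\<pi>" if "\<pi> \<in> pairings_on (A - {p, q})" for q \<pi>
    using that by (auto simp: pairings_on_def partition_on_def)
  have "bij_betw f ?S (pairings_on A)"
  proof (rule bij_betw_imageI)
    show "inj_on f ?S"
    proof (rule inj_onI)
      fix x y assume "x \<in> ?S" "y \<in> ?S" and fxy: "f x = f y"
      then obtain q \<pi> q' \<pi>' where xy: "x = (q, \<pi>)" "y = (q', \<pi>')" and h: "q \<in> A" "q \<noteq> p" "q' \<in> A" "q' \<noteq> p" "\<pi> \<in> pairings_on (A - {p, q})" "\<pi>' \<in> pairings_on (A - {p, q'})"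
        by blast
      have eq: "f (q, \<pi>) = f (q', \<pi>')" using fxy xy by simp
      have n: "p \<notin> \<Union>\<pi>" "p \<notin> \<Union>\<pi>'" by (rule notin(1)[OF h(5)], rule notin(1)[OF h(6)])
      have "{p, q} \<in> insert {p, q'} \<pi>'" using eq unfolding f_def prod.case by (metis insertI1)
      then have "{p, q} = {p, q'}" using n(2) by (metis UnionI insertE insertI1)
      then have "q = q'" using h(2,4) by (simp add: doubleton_eq_iff)
      moreover have "{p, q} \<notin> \<pi>" "{p, q'} \<notin> \<pi>'" using n by (metis UnionI insertI1)+
      then have "\<pi> = insert {p, q} \<pi> - {{p, q}}" "\<pi>' = insert {p, q'} \<pi>' - {{p, q'}}" by simp_all
      ultimately show "x = y" using eq unfolding f_def prod.case xy by metis
    qed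
    show "f ` ?S = pairings_on A"
    proof (intro equalityI subsetI)
      fix \<pi>' assume "\<pi>' \<in> f ` ?S"
      then obtain q \<pi> where \<pi>': "\<pi>' = f (q, \<pi>)" and h: "q \<in> A" "q \<noteq> p" "\<pi> \<in> pairings_on (A - {p, q})"
        by blast
      then have "disjnt {p, q} (\<Union>\<pi>)" using notin[OF h(3)] by (auto simp: disjnt_def)
      then show "\<pi>' \<in> pairings_on A"
        using h assms \<pi>' by (auto simp: f_def pairings_on_def partition_on_insert)
    next
      fix \<pi> assume h: "\<pi> \<in> pairings_on A"
      then obtain b where b: "b \<in> \<pi>" "p \<in> b" using assms by (auto simp: pairings_on_def partition_on_def)
      then have "card b = 2" using h by (auto simp: pairings_on_def)
      then obtain q where q: "b = {p, q}" "q \<noteq> p" using b by (auto simp: card_2_iff)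
      have "disjnt {p, q} (\<Union>(\<pi> - {{p, q}}))"
      proof -
        have "c \<inter> {p, q} = {}" if "c \<in> \<pi>" "c \<noteq> {p, q}" for c
          using that h disjointD[of \<pi> c b] b(1) unfolding q(1)
          by (simp add: pairings_on_def partition_on_def)
        then show ?thesis unfolding disjnt_def by blast
      qed
      moreover have eq: "insert {p, q} (\<pi> - {{p, q}}) = \<pi>" using b q by auto
      ultimately have "partition_on (A - {p, q}) (\<pi> - {{p, q}}) \<and> q \<in> A"
        using h partition_on_insert[of "{p, q}" "\<pi> - {{p, q}}" A] by (auto simp: pairings_on_def)
      then have "(q, \<pi> - {{p, q}}) \<in> ?S" using h q by (auto simp: pairings_on_def)
      moreover have "\<pi> = f (q, \<pi> - {{p, q}})" using eq by (simp add: f_def)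
      ultimately show "\<pi> \<in> f ` ?S" by blast
    qed
  qed
  then have "(\<Sum>\<pi>\<in>pairings_on A. h \<pi>) = (\<Sum>x\<in>?S. h (f x))"
    by (rule sum.reindex_bij_betw[symmetric])
  also have "\<dots> = (\<Sum>q\<in>A - {p}. \<Sum>\<pi>\<in>pairings_on (A - {p, q}). h (f (q, \<pi>)))"
    using assms by (subst sum.Sigma) (auto intro: finite_pairings_on)
  finally show ?thesis by (simp add: f_def)
qed

text \<open>
  The double factorial \<open>(m - 1)!!\<close> for even \<open>m\<close>, the \<open>m\<close>th moment of the standard normal distribution.
\<close>
definition normal_moment :: "nat \<Rightarrow> real" where
  "normal_moment m = (if even m then fact m / (2 ^ (m div 2) * fact (m div 2)) else 0)"

lemma normal_moment_simps:
  "normal_moment 0 = 1" "normal_moment (Suc 0) = 0"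
  "normal_moment (Suc (Suc m)) = real (Suc m) * normal_moment m"
proof -
  show "normal_moment (Suc (Suc m)) = real (Suc m) * normal_moment m"
  proof (cases "even m")
    case True
    then obtain b where b: "m = 2 * b" by (auto elim: evenE)
    have "fact (Suc (Suc m)) = 2 * (real b + 1) * real (Suc m) * fact m" "1 + real b \<noteq> 0"
      unfolding b by (simp_all add: algebra_simps add_nonneg_eq_0_iff)
    then show ?thesis
      using b unfolding normal_moment_def by (simp del: fact_Suc add: fact_Suc[of b] divide_simps)
  qed (simp add: normal_moment_def)
qed (auto simp: normal_moment_def)

lemma (in prob_space) normal_moment:
  assumes "distributed M lborel X std_normal_density"
  shows "integrable M (\<lambda>\<omega>. X \<omega> ^ m)" "expectation (\<lambda>\<omega>. X \<omega> ^ m) = normal_moment m"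
proof -
  show "integrable M (\<lambda>\<omega>. X \<omega> ^ m)"
    using distributed_integrable[OF assms, of "\<lambda>x. x ^ m"] integrable_std_normal_moment[of m] by simp
  have "expectation (\<lambda>\<omega>. X \<omega> ^ m) = (\<integral>x. std_normal_density x * x ^ m \<partial>lborel)"
    using distributed_integral[OF assms, of "\<lambda>x. x ^ m"] by simp
  also have "\<dots> = normal_moment m"
    using integral_std_normal_moment_even[of "m div 2"] integral_std_normal_moment_odd[of "m div 2"]
    by (cases "even m") (auto simp: normal_moment_def elim!: oddE)
  finally show "expectation (\<lambda>\<omega>. X \<omega> ^ m) = normal_moment m" .
qed

text \<open>
  Both sides satisfy the recursion obtained by choosing the partner \<open>q\<close> of a fixed \<open>p\<close>: on the left it
  is \<open>(m + 1)!! = (m + 1) (m - 1)!!\<close>, since the partner must come from the \<open>m + 1\<close> other elements of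
  the fibre of \<open>e\<close> through \<open>p\<close>.
\<close>
lemma prod_normal_moment_eq_sum_pairings:
  assumes "finite A" "finite C" "e ` A \<subseteq> C"
  shows "(\<Prod>c\<in>C. normal_moment (card {p \<in> A. e p = c})) = (\<Sum>\<pi>\<in>pairings_on A. \<Prod>b\<in>\<pi>. matched e b)"
  using assms(1,3)
proof (induction A rule: finite_psubset_induct)
  case (psubset A)
  show ?case
  proof (cases "A = {}")
    case True
    have "pairings_on ({} :: 'a set) = {{}}" by (auto simp: pairings_on_def partition_on_def)
    then show ?thesis using True by (simp add: normal_moment_simps)
  next
    case False
    then obtain p where p: "p \<in> A" by auto
    define Q where "Q = {q \<in> A - {p}. e q = e p}"
    define R where "R = (\<Prod>c\<in>C - {e p}. normal_moment (card {x \<in> A. e x = c}))"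
    have fin: "finite A" "finite Q" using psubset by (auto simp: Q_def)
    have epC: "e p \<in> C" using psubset p by auto
    have fibre: "{x \<in> A. e x = e p} = insert p Q" "p \<notin> Q" using p by (auto simp: Q_def)
    have block: "(\<Prod>b\<in>insert {p, q} \<pi>. matched e b) = of_bool (e q = e p) * (\<Prod>b\<in>\<pi>. matched e b)"
      if "\<pi> \<in> pairings_on (A - {p, q})" for q \<pi>
    proof -
      have "{p, q} \<notin> \<pi>" using that by (auto simp: pairings_on_def partition_on_def)
      moreover have "finite \<pi>" using that fin finite_pairing by blast
      ultimately show ?thesis by (auto simp: matched_def)
    qed
    have "(\<Sum>\<pi>\<in>pairings_on A. \<Prod>b\<in>\<pi>. matched e b) =
        (\<Sum>q\<in>A - {p}. \<Sum>\<pi>\<in>pairings_on (A - {p, q}). of_bool (e q = e p) * (\<Prod>b\<in>\<pi>. matched e b))"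
      using sum_pairings_on_remove[OF fin(1) p, where h = "\<lambda>\<pi>. \<Prod>b\<in>\<pi>. matched e b"] block
      by simp
    also have "\<dots> = (\<Sum>q\<in>A - {p}. if e q = e p then (\<Sum>\<pi>\<in>pairings_on (A - {p, q}). \<Prod>b\<in>\<pi>. matched e b) else 0)"
      by (intro sum.cong refl) auto
    also have "\<dots> = (\<Sum>q\<in>Q. \<Sum>\<pi>\<in>pairings_on (A - {p, q}). \<Prod>b\<in>\<pi>. matched e b)"
      unfolding Q_def using fin by (intro sum.inter_filter[symmetric]) simp
    also have "\<dots> = (\<Sum>q\<in>Q. normal_moment (card Q - 1) * R)"
    proof (rule sum.cong[OF refl])
      fix q assume q: "q \<in> Q"
      have "(\<Sum>\<pi>\<in>pairings_on (A - {p, q}). \<Prod>b\<in>\<pi>. matched e b) =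
          (\<Prod>c\<in>C. normal_moment (card {x \<in> A - {p, q}. e x = c}))"
      proof (rule psubset.IH[symmetric])
        show "A - {p, q} \<subset> A" "e ` (A - {p, q}) \<subseteq> C" using psubset.prems p by auto
      qed
      also have "\<dots> = normal_moment (card {x \<in> A - {p, q}. e x = e p}) *
          (\<Prod>c\<in>C - {e p}. normal_moment (card {x \<in> A - {p, q}. e x = c}))"
        using assms(2) epC by (rule prod.remove)
      also have "{x \<in> A - {p, q}. e x = e p} = Q - {q}" by (auto simp: Q_def)
      also have "(\<Prod>c\<in>C - {e p}. normal_moment (card {x \<in> A - {p, q}. e x = c})) = R"
        unfolding R_def using q
        by (intro prod.cong refl arg_cong[where f = normal_moment] arg_cong[where f = card])
          (auto simp: Q_def)
      finally show "(\<Sum>\<pi>\<in>pairings_on (A - {p, q}). \<Prod>b\<in>\<pi>. matched e b) = normal_moment (card Q - 1) * R"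
        using q by simp
    qed
    also have "\<dots> = real (card Q) * normal_moment (card Q - 1) * R" by simp
    \<comment> \<open>for empty \<open>Q\<close> both sides are \<open>0\<close>, the first moment\<close>
    also have "real (card Q) * normal_moment (card Q - 1) = normal_moment (Suc (card Q))"
      by (cases "card Q") (simp_all only: normal_moment_simps, simp_all)
    also have "Suc (card Q) = card {x \<in> A. e x = e p}" using fibre fin by simp
    also have "normal_moment \<dots> * R = (\<Prod>c\<in>C. normal_moment (card {x \<in> A. e x = c}))"
      unfolding R_def using assms(2) epC by (rule prod.remove[symmetric])
    finally show ?thesis ..
  qed
qed

text \<open>
  Grouping equal variables splits the expectation into moments of independent normal variables.
\<close>
lemma (in prob_space) wick:
  assumes "finite A" "finite C" "e ` A \<subseteq> C"
    and "indep_vars (\<lambda>_. borel) F C"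
    and "\<And>c. c \<in> C \<Longrightarrow> distributed M lborel (F c) std_normal_density"
  shows "integrable M (\<lambda>\<omega>. \<Prod>p\<in>A. F (e p) \<omega>)"
    and "expectation (\<lambda>\<omega>. \<Prod>p\<in>A. F (e p) \<omega>) = (\<Sum>\<pi>\<in>pairings_on A. \<Prod>b\<in>\<pi>. matched e b)"
proof -
  define m where "m c = card {p \<in> A. e p = c}" for c
  have grp: "(\<Prod>p\<in>A. F (e p) \<omega>) = (\<Prod>c\<in>C. F c \<omega> ^ m c)" for \<omega>
  proof -
    have "(\<Prod>c\<in>C. \<Prod>p\<in>{p \<in> A. e p = c}. F (e p) \<omega>) = (\<Prod>p\<in>A. F (e p) \<omega>)"
      using assms(1-3) by (rule prod.group)
    moreover have "(\<Prod>p\<in>{p \<in> A. e p = c}. F (e p) \<omega>) = F c \<omega> ^ m c" for c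
      by (simp add: m_def)
    ultimately show ?thesis by simp
  qed
  have ind: "indep_vars (\<lambda>_. borel) (\<lambda>c \<omega>. F c \<omega> ^ m c) C"
    using assms(4) by (rule indep_vars_compose2[where Y = "\<lambda>c x. x ^ m c"]) simp
  show "integrable M (\<lambda>\<omega>. \<Prod>p\<in>A. F (e p) \<omega>)"
    unfolding grp using normal_moment(1)[OF assms(5)] by (intro indep_vars_integrable assms(2) ind) auto
  have "expectation (\<lambda>\<omega>. \<Prod>p\<in>A. F (e p) \<omega>) = (\<Prod>c\<in>C. normal_moment (m c))"
    unfolding grp using normal_moment[OF assms(5)]
    by (subst indep_vars_lebesgue_integral[OF assms(2) ind]) auto
  then show "expectation (\<lambda>\<omega>. \<Prod>p\<in>A. F (e p) \<omega>) = (\<Sum>\<pi>\<in>pairings_on A. \<Prod>b\<in>\<pi>. matched e b)"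
    using prod_normal_moment_eq_sum_pairings[OF assms(1-3)] by (simp add: m_def)
qed

section \<open>Connected components of a pairing\<close>

text \<open>
  Every block of \<open>\<pi>\<close> is regarded as joining the labels of its elements; the saturated sets are the
  unions of connected components of labels.
\<close>
definition saturated :: "('p \<Rightarrow> 'k) \<Rightarrow> 'p set set \<Rightarrow> 'k set \<Rightarrow> bool" where
  "saturated L \<pi> K \<longleftrightarrow> (\<forall>b\<in>\<pi>. L ` b \<subseteq> K \<or> L ` b \<inter> K = {})"

text \<open>
  Connectedness is expressed by saturated sets instead of paths because these sets are closed under
  intersection and difference, which is all that the theory of components needs.
\<close>
definition connected_via :: "('p \<Rightarrow> 'k) \<Rightarrow> 'p set set \<Rightarrow> 'k set \<Rightarrow> bool" where
  "connected_via L \<pi> J \<longleftrightarrow> (\<forall>K\<subseteq>J. K \<noteq> {} \<longrightarrow> saturated L \<pi> K \<longrightarrow> K = J)"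

definition component :: "('p \<Rightarrow> 'k) \<Rightarrow> 'p set set \<Rightarrow> 'k set \<Rightarrow> 'k \<Rightarrow> 'k set" where
  "component L \<pi> J k = \<Inter>{K. K \<subseteq> J \<and> k \<in> K \<and> saturated L \<pi> K}"

definition connected_pairings :: "'p set \<Rightarrow> ('p \<Rightarrow> 'k) \<Rightarrow> 'k set \<Rightarrow> 'p set set set" where
  "connected_pairings V L J = {\<pi> \<in> pairings_on (V \<inter> L -` J). connected_via L \<pi> J}"

lemma component_least: "K \<subseteq> J \<Longrightarrow> k \<in> K \<Longrightarrow> saturated L \<pi> K \<Longrightarrow> component L \<pi> J k \<subseteq> K"
  by (auto simp: component_def)

lemma self_in_component: "k \<in> component L \<pi> J k"
  by (auto simp: component_def)

text \<open>
  If \<open>j\<close> lies in the component of \<open>k\<close>, then \<open>k\<close> lies in that of \<open>j\<close>: otherwise removing the component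
  of \<open>j\<close> from that of \<open>k\<close> would leave a smaller saturated set containing \<open>k\<close>.
\<close>

lemma component_facts:
  assumes "\<pi> \<in> pairings_on (V \<inter> L -` J)" "k \<in> J"
  shows component_subset: "component L \<pi> J k \<subseteq> J"
    and saturated_component: "saturated L \<pi> (component L \<pi> J k)"
    and component_eq: "j \<in> component L \<pi> J k \<Longrightarrow> component L \<pi> J j = component L \<pi> J k"
proof -
  have sat: "saturated L \<pi> J"
    using assms(1) by (fastforce simp: saturated_def pairings_on_def partition_on_def)
  have sub: "component L \<pi> J k \<subseteq> J" and satc: "saturated L \<pi> (component L \<pi> J k)" if "k \<in> J" for k
  proof -
    show "component L \<pi> J k \<subseteq> J" using sat that by (intro component_least) auto
    show "saturated L \<pi> (component L \<pi> J k)"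
      unfolding saturated_def
    proof (intro ballI disjCI)
      fix b assume b: "b \<in> \<pi>" "L ` b \<inter> component L \<pi> J k \<noteq> {}"
      then have "L ` b \<subseteq> K" if "K \<subseteq> J" "k \<in> K" "saturated L \<pi> K" for K
        using that component_least[of K J k L \<pi>] unfolding saturated_def by blast
      then show "L ` b \<subseteq> component L \<pi> J k" by (auto simp: component_def)
    qed
  qed
  show "component L \<pi> J k \<subseteq> J" "saturated L \<pi> (component L \<pi> J k)" using sub satc assms by auto
  assume j: "j \<in> component L \<pi> J k"
  then have jJ: "j \<in> J" using sub assms by auto
  have 1: "component L \<pi> J j \<subseteq> component L \<pi> J k"
    by (rule component_least[OF sub[OF assms(2)] j satc[OF assms(2)]])
  have "k \<in> component L \<pi> J j"
  proof (rule ccontr)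
    assume "k \<notin> component L \<pi> J j"
    moreover have "saturated L \<pi> (component L \<pi> J k - component L \<pi> J j)"
      using satc[OF assms(2)] satc[OF jJ] unfolding saturated_def by blast
    ultimately have "component L \<pi> J k \<subseteq> component L \<pi> J k - component L \<pi> J j"
      using sub[OF assms(2)] self_in_component[of k L \<pi> J] by (intro component_least) blast+
    then show False using j self_in_component[of j L \<pi> J] by auto
  qed
  then have "component L \<pi> J k \<subseteq> component L \<pi> J j"
    by (intro component_least sub[OF jJ] satc[OF jJ])
  with 1 show "component L \<pi> J j = component L \<pi> J k" by auto
qed

lemma partition_on_components:
  assumes "\<pi> \<in> pairings_on (V \<inter> L -` J)"
  shows "partition_on J (component L \<pi> J ` J)"
proof (rule partition_onI)
  show "\<Union>(component L \<pi> J ` J) = J"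
    using component_subset[OF assms] self_in_component[of _ L \<pi> J] by blast
  show "disjnt B B'" if "B \<in> component L \<pi> J ` J" "B' \<in> component L \<pi> J ` J" "B \<noteq> B'" for B B'
  proof (rule ccontr)
    assume "\<not> disjnt B B'"
    then obtain j where "j \<in> B" "j \<in> B'" by (auto simp: disjnt_def)
    then have "component L \<pi> J j = B" "component L \<pi> J j = B'"
      using that component_eq[OF assms] by auto
    with that(3) show False by simp
  qed
  show "{} \<notin> component L \<pi> J ` J" using self_in_component[of _ L \<pi> J] by blast
qed

text \<open>
  A subset of a component that is saturated for the restriction is saturated for the whole pairing, so
  if nonempty it is the component.
\<close>
lemma restriction_to_component:
  assumes "\<pi> \<in> pairings_on (V \<inter> L -` J)" "B \<in> component L \<pi> J ` J"
  shows "{b \<in> \<pi>. L ` b \<subseteq> B} \<in> connected_pairings V L B"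
proof -
  obtain k where k: "k \<in> J" "B = component L \<pi> J k" using assms(2) by auto
  have BJ: "B \<subseteq> J" and sat: "saturated L \<pi> B"
    using k component_subset[OF assms(1)] saturated_component[OF assms(1)] by auto
  have P: "partition_on (V \<inter> L -` J) \<pi>" using assms(1) by (auto simp: pairings_on_def)
  have "\<Union>{b \<in> \<pi>. L ` b \<subseteq> B} = V \<inter> L -` B"
  proof
    show "\<Union>{b \<in> \<pi>. L ` b \<subseteq> B} \<subseteq> V \<inter> L -` B" using P by (auto simp: partition_on_def)
    show "V \<inter> L -` B \<subseteq> \<Union>{b \<in> \<pi>. L ` b \<subseteq> B}"
    proof
      fix p assume p: "p \<in> V \<inter> L -` B"
      then obtain b where b: "b \<in> \<pi>" "p \<in> b" using P BJ by (auto simp: partition_on_def)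
      then have "L ` b \<subseteq> B" using sat p by (auto simp: saturated_def)
      with b show "p \<in> \<Union>{b \<in> \<pi>. L ` b \<subseteq> B}" by auto
    qed
  qed
  then have pair: "{b \<in> \<pi>. L ` b \<subseteq> B} \<in> pairings_on (V \<inter> L -` B)"
    using assms(1) by (auto simp: pairings_on_def partition_on_def disjoint_def)
  have "connected_via L {b \<in> \<pi>. L ` b \<subseteq> B} B"
    unfolding connected_via_def
  proof (intro allI impI)
    fix K assume K: "K \<subseteq> B" "K \<noteq> {}" "saturated L {b \<in> \<pi>. L ` b \<subseteq> B} K"
    then obtain j where j: "j \<in> K" by auto
    have "saturated L \<pi> K" using K sat unfolding saturated_def by blast
    then have "component L \<pi> J j \<subseteq> K" using K BJ j by (intro component_least) auto
    moreover have "component L \<pi> J j = B" using component_eq[OF assms(1) k(1), of j] j K k by auto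
    ultimately show "K = B" using K by auto
  qed
  with pair show ?thesis by (simp add: connected_pairings_def)
qed

text \<open>
  Conversely, a partition \<open>\<rho>\<close> of the labels and connected pairings \<open>\<phi> B\<close> over its blocks glue to a
  pairing whose components are the blocks of \<open>\<rho>\<close>, and from which the \<open>\<phi> B\<close> are recovered.
\<close>
context
  fixes V :: "'p set" and L :: "'p \<Rightarrow> 'k" and J :: "'k set" and \<rho> :: "'k set set"
    and \<phi> :: "'k set \<Rightarrow> 'p set set"
  assumes \<rho>: "partition_on J \<rho>" and choice: "\<phi> \<in> Pi \<rho> (connected_pairings V L)"
begin

lemma block_labels: "B \<in> \<rho> \<Longrightarrow> b \<in> \<phi> B \<Longrightarrow> b \<noteq> {} \<and> L ` b \<subseteq> B"
  using Pi_mem[OF choice, of B] by (fastforce simp: connected_pairings_def pairings_on_def partition_on_def)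

lemma block_labels_iff:
  assumes "B \<in> \<rho>" "B' \<in> \<rho>" "b \<in> \<phi> B'"
  shows "L ` b \<subseteq> B \<longleftrightarrow> B = B'" "L ` b \<inter> B \<noteq> {} \<longleftrightarrow> B = B'"
proof -
  have "B \<inter> B' = {}" if "B \<noteq> B'" using that assms \<rho> by (auto simp: partition_on_def disjoint_def)
  then show "L ` b \<subseteq> B \<longleftrightarrow> B = B'" "L ` b \<inter> B \<noteq> {} \<longleftrightarrow> B = B'" using block_labels[OF assms(2,3)] by blast+
qed

lemma Union_connected_pairings: "(\<Union>B\<in>\<rho>. \<phi> B) \<in> pairings_on (V \<inter> L -` J)"
proof -
  have P: "partition_on (V \<inter> L -` B) (\<phi> B)" "\<forall>b\<in>\<phi> B. card b = 2" if "B \<in> \<rho>" for B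
    using Pi_mem[OF choice that] by (auto simp: connected_pairings_def pairings_on_def)
  have "partition_on (V \<inter> L -` J) (\<Union>B\<in>\<rho>. \<phi> B)"
  proof (rule partition_onI)
    have "\<Union>(\<Union>B\<in>\<rho>. \<phi> B) = (\<Union>B\<in>\<rho>. \<Union>(\<phi> B))" by blast
    also have "\<dots> = (\<Union>B\<in>\<rho>. V \<inter> L -` B)" using P(1) by (simp add: partition_on_def)
    also have "\<dots> = V \<inter> L -` J" using \<rho> by (auto simp: partition_on_def)
    finally show "\<Union>(\<Union>B\<in>\<rho>. \<phi> B) = V \<inter> L -` J" .
    show "{} \<notin> (\<Union>B\<in>\<rho>. \<phi> B)" using block_labels by auto
    show "disjnt b b'" if bb: "b \<in> (\<Union>B\<in>\<rho>. \<phi> B)" "b' \<in> (\<Union>B\<in>\<rho>. \<phi> B)" "b \<noteq> b'" for b b'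
    proof -
      obtain B B' where B: "B \<in> \<rho>" "b \<in> \<phi> B" "B' \<in> \<rho>" "b' \<in> \<phi> B'" using bb by auto
      show ?thesis
      proof (cases "B = B'")
        case True
        then show ?thesis using P(1)[OF B(1)] B bb by (auto simp: partition_on_def disjoint_def disjnt_def)
      next
        case False
        then have "L ` b' \<inter> B = {}" using block_labels_iff[OF B(1) B(3,4)] by auto
        then show ?thesis using block_labels[OF B(1,2)] by (auto simp: disjnt_def)
      qed
    qed
  qed
  then show ?thesis using P(2) by (auto simp: pairings_on_def)
qed

lemma Union_connected_pairings_restrict:
  "B \<in> \<rho> \<Longrightarrow> {b \<in> (\<Union>B\<in>\<rho>. \<phi> B). L ` b \<subseteq> B} = \<phi> B"
  using block_labels_iff(1)[of B] by blast

lemma component_Union_connected_pairings: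
  assumes "B \<in> \<rho>" "k \<in> B"
  shows "component L (\<Union>B\<in>\<rho>. \<phi> B) J k = B"
proof (rule equalityI)
  let ?\<pi> = "\<Union>B\<in>\<rho>. \<phi> B"
  have "saturated L ?\<pi> B"
    using block_labels_iff assms(1) unfolding saturated_def by blast
  moreover have "B \<subseteq> J" using \<rho> assms by (auto simp: partition_on_def)
  ultimately show "component L ?\<pi> J k \<subseteq> B" using assms by (intro component_least)
  show "B \<subseteq> component L ?\<pi> J k"
    unfolding component_def
  proof (rule Inter_greatest, clarify)
    fix K j assume K: "k \<in> K" "saturated L ?\<pi> K" and j: "j \<in> B"
    have "saturated L (\<phi> B) (K \<inter> B)"
      unfolding saturated_def
    proof
      fix b assume b: "b \<in> \<phi> B"
      then have "L ` b \<subseteq> B" "L ` b \<subseteq> K \<or> L ` b \<inter> K = {}"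
        using block_labels[OF assms(1) b] K(2) assms(1) by (auto simp: saturated_def)
      then show "L ` b \<subseteq> K \<inter> B \<or> L ` b \<inter> (K \<inter> B) = {}" by auto
    qed
    moreover have "K \<inter> B \<noteq> {}" using K assms by auto
    ultimately have "K \<inter> B = B"
      using Pi_mem[OF choice assms(1)] by (auto simp: connected_pairings_def connected_via_def)
    then show "j \<in> K" using j by auto
  qed
qed

lemma components_Union_connected_pairings: "component L (\<Union>B\<in>\<rho>. \<phi> B) J ` J = \<rho>"
proof -
  have J: "J = \<Union>\<rho>" "{} \<notin> \<rho>" using \<rho> by (auto simp: partition_on_def)
  show ?thesis
  proof
    show "component L (\<Union>B\<in>\<rho>. \<phi> B) J ` J \<subseteq> \<rho>"
      using component_Union_connected_pairings J(1) by auto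
    show "\<rho> \<subseteq> component L (\<Union>B\<in>\<rho>. \<phi> B) J ` J"
    proof
      fix B assume "B \<in> \<rho>"
      moreover from this J obtain k where "k \<in> B" by fastforce
      ultimately show "B \<in> component L (\<Union>B\<in>\<rho>. \<phi> B) J ` J"
        using component_Union_connected_pairings J(1) by (metis UnionI image_eqI)
    qed
  qed
qed

lemma prod_Union_connected_pairings:
  fixes w :: "'p set \<Rightarrow> real"
  assumes "finite V" "finite J"
  shows "(\<Prod>b\<in>(\<Union>B\<in>\<rho>. \<phi> B). w b) = (\<Prod>B\<in>\<rho>. \<Prod>b\<in>\<phi> B. w b)"
proof (rule prod.UNION_disjoint)
  show "finite \<rho>" using \<rho> assms finite_elements by blast
  show "\<forall>B\<in>\<rho>. finite (\<phi> B)"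
    using Pi_mem[OF choice] assms finite_pairing[of "V \<inter> L -` B" for B] by (auto simp: connected_pairings_def)
  show "\<forall>B\<in>\<rho>. \<forall>B'\<in>\<rho>. B \<noteq> B' \<longrightarrow> \<phi> B \<inter> \<phi> B' = {}"
    using block_labels_iff(1) by blast
qed

end

text \<open>
  A pairing corresponds to the partition of the labels into its components together with its
  restrictions to them. Weights that are products over the blocks of the pairing factor accordingly.
\<close>
lemma sum_pairings_eq_sum_connected:
  fixes w :: "'p set \<Rightarrow> real"
  assumes "finite V" "finite J"
  shows "(\<Sum>\<pi>\<in>pairings_on (V \<inter> L -` J). \<Prod>b\<in>\<pi>. w b) =
    (\<Sum>\<rho> | partition_on J \<rho>. \<Prod>B\<in>\<rho>. \<Sum>\<pi>\<in>connected_pairings V L B. \<Prod>b\<in>\<pi>. w b)"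
proof -
  let ?C = "connected_pairings V L"
  let ?S = "SIGMA \<rho>:{\<rho>. partition_on J \<rho>}. PiE \<rho> ?C"
  have finC: "finite (?C B)" for B
    using assms finite_pairings_on[of "V \<inter> L -` B"] by (auto simp: connected_pairings_def)
  have finP: "finite {\<rho>. partition_on J \<rho>}" "\<And>\<rho>. partition_on J \<rho> \<Longrightarrow> finite \<rho>"
    using finitely_many_partition_on[OF assms(2)] finite_elements[OF assms(2)] by auto
  have "(\<Sum>\<rho> | partition_on J \<rho>. \<Prod>B\<in>\<rho>. \<Sum>\<pi>\<in>?C B. \<Prod>b\<in>\<pi>. w b) =
      (\<Sum>\<rho> | partition_on J \<rho>. \<Sum>\<phi>\<in>PiE \<rho> ?C. \<Prod>B\<in>\<rho>. \<Prod>b\<in>\<phi> B. w b)"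
    using finC finP by (intro sum.cong refl prod_sum_PiE) auto
  also have "\<dots> = (\<Sum>(\<rho>, \<phi>)\<in>?S. \<Prod>B\<in>\<rho>. \<Prod>b\<in>\<phi> B. w b)"
    using finC finP by (intro sum.Sigma) (auto intro: finite_PiE)
  also have "\<dots> = (\<Sum>\<pi>\<in>pairings_on (V \<inter> L -` J). \<Prod>b\<in>\<pi>. w b)"
  proof (rule sum.reindex_bij_witness[where j = "\<lambda>(\<rho>, \<phi>). \<Union>B\<in>\<rho>. \<phi> B" and
        i = "\<lambda>\<pi>. (component L \<pi> J ` J, \<lambda>B\<in>component L \<pi> J ` J. {b \<in> \<pi>. L ` b \<subseteq> B})"])
    fix x assume "x \<in> ?S"
    then obtain \<rho> \<phi> where x: "x = (\<rho>, \<phi>)" "partition_on J \<rho>" "\<phi> \<in> PiE \<rho> ?C" by auto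
    then have \<phi>: "\<phi> \<in> Pi \<rho> ?C" by (simp add: PiE_def)
    note * = Union_connected_pairings[OF x(2) \<phi>] Union_connected_pairings_restrict[OF x(2) \<phi>]
      components_Union_connected_pairings[OF x(2) \<phi>] prod_Union_connected_pairings[OF x(2) \<phi> assms]
    let ?\<pi> = "\<Union>B\<in>\<rho>. \<phi> B"
    have "(\<lambda>B\<in>\<rho>. {b \<in> ?\<pi>. L ` b \<subseteq> B}) = \<phi>"
      using *(2) x(3) by (auto simp: fun_eq_iff PiE_def extensional_def restrict_def)
    then show "(component L (case x of (\<rho>, \<phi>) \<Rightarrow> \<Union>B\<in>\<rho>. \<phi> B) J ` J,
        \<lambda>B\<in>component L (case x of (\<rho>, \<phi>) \<Rightarrow> \<Union>B\<in>\<rho>. \<phi> B) J ` J.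
          {b \<in> (case x of (\<rho>, \<phi>) \<Rightarrow> \<Union>B\<in>\<rho>. \<phi> B). L ` b \<subseteq> B}) = x"
      unfolding x(1) prod.case *(3) by simp
    show "(case x of (\<rho>, \<phi>) \<Rightarrow> \<Union>B\<in>\<rho>. \<phi> B) \<in> pairings_on (V \<inter> L -` J)"
      using * x(1) by simp
    show "(\<Prod>b\<in>(case x of (\<rho>, \<phi>) \<Rightarrow> \<Union>B\<in>\<rho>. \<phi> B). w b) = (case x of (\<rho>, \<phi>) \<Rightarrow> \<Prod>B\<in>\<rho>. \<Prod>b\<in>\<phi> B. w b)"
      using * x(1) by simp
  next
    fix \<pi> assume \<pi>: "\<pi> \<in> pairings_on (V \<inter> L -` J)"
    let ?\<rho> = "component L \<pi> J ` J"
    show "(?\<rho>, \<lambda>B\<in>?\<rho>. {b \<in> \<pi>. L ` b \<subseteq> B}) \<in> ?S"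
      using partition_on_components[OF \<pi>] restriction_to_component[OF \<pi>] by auto
    have "(\<Union>B\<in>?\<rho>. {b \<in> \<pi>. L ` b \<subseteq> B}) = \<pi>"
    proof (intro equalityI subsetI)
      fix b assume b: "b \<in> \<pi>"
      then have "b \<noteq> {}" "b \<subseteq> V \<inter> L -` J" using \<pi> by (auto simp: pairings_on_def partition_on_def)
      then obtain p where p: "p \<in> b" "L p \<in> J" by auto
      then have "L ` b \<subseteq> component L \<pi> J (L p)"
        using saturated_component[OF \<pi> p(2)] self_in_component[of "L p" L \<pi> J] b unfolding saturated_def by blast
      then show "b \<in> (\<Union>B\<in>?\<rho>. {b \<in> \<pi>. L ` b \<subseteq> B})" using b p by auto
    qed auto
    then show "(case (?\<rho>, \<lambda>B\<in>?\<rho>. {b \<in> \<pi>. L ` b \<subseteq> B}) of (\<rho>, \<phi>) \<Rightarrow> \<Union>B\<in>\<rho>. \<phi> B) = \<pi>"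
      by simp
  qed
  finally show ?thesis ..
qed

section \<open>Cumulants of Gaussian forms\<close>

text \<open>
  The connected pairings satisfy the moment-cumulant formula, which determines the cumulants.
  Locality of the coefficients, that \<open>coef k\<close> sees only the positions labelled \<open>k\<close>, is what
  makes the sum over \<open>e\<close> factor along the components.
\<close>
lemma (in prob_space) cumulant_gaussian_forms:
  fixes Z :: "'k \<Rightarrow> 'a \<Rightarrow> real" and F :: "'c \<Rightarrow> 'a \<Rightarrow> real" and coef :: "'k \<Rightarrow> ('p \<Rightarrow> 'c) \<Rightarrow> real"
  assumes "finite I" "I \<noteq> {}" "finite V" "finite C"
    and ind: "indep_vars (\<lambda>_. borel) F C"
    and dist: "\<And>c. c \<in> C \<Longrightarrow> distributed M lborel (F c) std_normal_density"
    and Z: "\<And>k \<omega>. k \<in> I \<Longrightarrow>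
      Z k \<omega> = (\<Sum>e\<in>PiE (V \<inter> L -` {k}) (\<lambda>_. C). coef k e * (\<Prod>p\<in>V \<inter> L -` {k}. F (e p) \<omega>))"
    and local: "\<And>k e. k \<in> I \<Longrightarrow> coef k (restrict e (V \<inter> L -` {k})) = coef k e"
  shows "cumulant M Z I = (\<Sum>\<pi>\<in>connected_pairings V L I.
    \<Sum>e\<in>PiE (V \<inter> L -` I) (\<lambda>_. C). (\<Prod>k\<in>I. coef k e) * (\<Prod>b\<in>\<pi>. matched e b))"
proof -
  define w where "w B e = (\<Prod>k\<in>B. coef k e) * (\<Sum>\<pi>\<in>connected_pairings V L B. \<Prod>b\<in>\<pi>. matched e b)" for B e
  define \<kappa> where "\<kappa> B = (\<Sum>e\<in>PiE (V \<inter> L -` B) (\<lambda>_. C). w B e)" for B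
  have w_local: "w B (restrict e (V \<inter> L -` B)) = w B e" if "B \<subseteq> I" for B e
  proof -
    have "coef k (restrict e (V \<inter> L -` B)) = coef k e" if k: "k \<in> B" for k
    proof -
      have "(V \<inter> L -` B) \<inter> (V \<inter> L -` {k}) = V \<inter> L -` {k}" using k by auto
      then have "coef k (restrict (restrict e (V \<inter> L -` B)) (V \<inter> L -` {k})) = coef k (restrict e (V \<inter> L -` {k}))"
        by (simp only: restrict_restrict)
      moreover have "k \<in> I" using k \<open>B \<subseteq> I\<close> by auto
      ultimately show ?thesis by (simp only: local)
    qed
    moreover have "matched (restrict e (V \<inter> L -` B)) b = matched e b"
      if "\<pi> \<in> connected_pairings V L B" "b \<in> \<pi>" for \<pi> b
    proof -
      have "b \<subseteq> V \<inter> L -` B"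
        using that by (auto simp: connected_pairings_def pairings_on_def partition_on_def)
      then show ?thesis by (auto simp: matched_def subset_iff)
    qed
    ultimately show ?thesis by (simp add: w_def)
  qed
  have "\<kappa> I = cumulant M Z I"
  proof (rule cumulant_unique)
    fix J assume J: "J \<subseteq> I" "J \<noteq> {}"
    define U where "U = V \<inter> L -` J"
    have finJ: "finite J" using J(1) assms(1) by (rule finite_subset)
    have finU: "finite U" using assms(3) by (simp add: U_def)
    have U: "U = (\<Union>k\<in>J. V \<inter> L -` {k})" by (auto simp: U_def)
    have prodZ: "(\<Prod>k\<in>J. Z k \<omega>) =
        (\<Sum>e\<in>PiE U (\<lambda>_. C). (\<Prod>k\<in>J. coef k e) * (\<Prod>p\<in>U. F (e p) \<omega>))" for \<omega>
    proof -
      have "(\<Prod>k\<in>J. Z k \<omega>) =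
          (\<Prod>k\<in>J. \<Sum>e\<in>PiE (V \<inter> L -` {k}) (\<lambda>_. C). coef k e * (\<Prod>p\<in>V \<inter> L -` {k}. F (e p) \<omega>))"
        using J Z by (intro prod.cong) auto
      also have "\<dots> = (\<Sum>e\<in>PiE U (\<lambda>_. C). \<Prod>k\<in>J. coef k e * (\<Prod>p\<in>V \<inter> L -` {k}. F (e p) \<omega>))"
        unfolding U using J assms finJ
        by (intro sum_PiE_UNION_prod[symmetric]) (auto simp: subset_iff)
      also have "\<dots> = (\<Sum>e\<in>PiE U (\<lambda>_. C). (\<Prod>k\<in>J. coef k e) * (\<Prod>p\<in>U. F (e p) \<omega>))"
        unfolding prod.distrib U using assms finJ by (subst prod.UNION_disjoint) auto
      finally show ?thesis .
    qed
    have img: "e ` U \<subseteq> C" if "e \<in> PiE U (\<lambda>_. C)" for e using that by auto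
    note wick' = wick[OF finU assms(4) img ind dist]
    have "(\<integral>\<omega>. (\<Prod>k\<in>J. Z k \<omega>) \<partial>M) =
        (\<Sum>e\<in>PiE U (\<lambda>_. C). \<integral>\<omega>. (\<Prod>k\<in>J. coef k e) * (\<Prod>p\<in>U. F (e p) \<omega>) \<partial>M)"
      unfolding prodZ using wick'(1) by (intro Bochner_Integration.integral_sum) simp
    also have "\<dots> = (\<Sum>e\<in>PiE U (\<lambda>_. C). (\<Prod>k\<in>J. coef k e) * (\<Sum>\<pi>\<in>pairings_on U. \<Prod>b\<in>\<pi>. matched e b))"
      using wick' by (intro sum.cong refl) simp
    also have "\<dots> = (\<Sum>e\<in>PiE U (\<lambda>_. C). \<Sum>\<rho> | partition_on J \<rho>. \<Prod>B\<in>\<rho>. w B e)"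
    proof (rule sum.cong[OF refl])
      fix e
      have coefJ: "(\<Prod>k\<in>J. coef k e) = (\<Prod>B\<in>\<rho>. \<Prod>k\<in>B. coef k e)" if "partition_on J \<rho>" for \<rho>
      proof -
        have "finite B" if "B \<in> \<rho>" for B
          using finite_subset[OF _ finJ] that \<open>partition_on J \<rho>\<close> unfolding partition_on_def by blast
        then show ?thesis
          using that prod.Union_disjoint_sets[of \<rho> "\<lambda>k. coef k e"] by (auto simp: partition_on_def)
      qed
      show "(\<Prod>k\<in>J. coef k e) * (\<Sum>\<pi>\<in>pairings_on U. \<Prod>b\<in>\<pi>. matched e b) =
          (\<Sum>\<rho> | partition_on J \<rho>. \<Prod>B\<in>\<rho>. w B e)"
        unfolding U_def sum_pairings_eq_sum_connected[OF assms(3) finJ] w_def prod.distrib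
        by (subst sum_distrib_left, rule sum.cong) (simp_all add: coefJ)
    qed
    also have "\<dots> = (\<Sum>\<rho> | partition_on J \<rho>. \<Sum>e\<in>PiE U (\<lambda>_. C). \<Prod>B\<in>\<rho>. w B e)"
      by (rule sum.swap)
    also have "\<dots> = (\<Sum>\<rho> | partition_on J \<rho>. \<Prod>B\<in>\<rho>. \<kappa> B)"
    proof (rule sum.cong[OF refl])
      fix \<rho> assume "\<rho> \<in> {\<rho>. partition_on J \<rho>}"
      then have \<rho>: "partition_on J \<rho>" by simp
      then have U': "U = (\<Union>B\<in>\<rho>. V \<inter> L -` B)" by (auto simp: U_def partition_on_def)
      have BI: "B \<subseteq> I" if "B \<in> \<rho>" for B using that \<rho> J by (auto simp: partition_on_def)
      have "B \<inter> B' = {}" if "B \<in> \<rho>" "B' \<in> \<rho>" "B \<noteq> B'" for B B'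
        using that \<rho> by (auto simp: partition_on_def disjoint_def)
      then have disj: "(V \<inter> L -` B) \<inter> (V \<inter> L -` B') = {}" if "B \<in> \<rho>" "B' \<in> \<rho>" "B \<noteq> B'" for B B'
        using that by blast
      have "finite \<rho>" using \<rho> finJ finite_elements by blast
      then show "(\<Sum>e\<in>PiE U (\<lambda>_. C). \<Prod>B\<in>\<rho>. w B e) = (\<Prod>B\<in>\<rho>. \<kappa> B)"
        unfolding \<kappa>_def U' using assms(3,4) w_local[OF BI] disj
        by (intro sum_PiE_UNION_prod) (assumption | simp)+
    qed
    finally show "(\<integral>\<omega>. (\<Prod>k\<in>J. Z k \<omega>) \<partial>M) = (\<Sum>\<rho> | partition_on J \<rho>. \<Prod>B\<in>\<rho>. \<kappa> B)" .
  qed (use assms in auto)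
  then show ?thesis
    unfolding \<kappa>_def w_def sum_distrib_left by (simp only: sum.swap[of _ _ "connected_pairings V L I"])
qed


section \<open>The intervals and the permutation \<open>\<gamma>\<close>\<close>

lemma psum_0: "psum ns 0 = 0"
  by (simp add: psum_def)

lemma psum_mono: "j \<le> k \<Longrightarrow> psum ns j \<le> psum ns k"
  unfolding psum_def by (rule sum_mono2) auto

lemma psum_rec: "1 \<le> k \<Longrightarrow> psum ns k = psum ns (k - 1) + ns k"
  by (cases k) (auto simp: psum_def)

text \<open>
  The number of the interval that contains the position \<open>p\<close>.
\<close>
definition interval_label :: "(nat \<Rightarrow> nat) \<Rightarrow> nat \<Rightarrow> nat" where
  "interval_label ns p = (LEAST k. p \<le> 2 * psum ns k)"

lemma interval_label_eqI:
  assumes "2 * psum ns (k - 1) < p" "p \<le> 2 * psum ns k"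
  shows "interval_label ns p = k"
  unfolding interval_label_def
proof (rule Least_equality)
  fix j assume "p \<le> 2 * psum ns j"
  then show "k \<le> j" using psum_mono[of j "k - 1" ns] assms by (cases "j \<le> k - 1") auto
qed (use assms in auto)

lemma interval_label_bounds:
  assumes "p \<in> {1..2 * psum ns r}"
  shows "interval_label ns p \<in> {1..r}"
    and "p \<in> {2 * psum ns (interval_label ns p - 1) + 1..2 * psum ns (interval_label ns p)}"
proof -
  let ?k = "interval_label ns p"
  have r: "p \<le> 2 * psum ns r" using assms by simp
  have up: "p \<le> 2 * psum ns ?k" "?k \<le> r"
    unfolding interval_label_def using r by (rule LeastI, rule Least_le)
  have pos: "?k \<noteq> 0" using up(1) assms psum_0[of ns] by (intro notI) simp
  then have "2 * psum ns (?k - 1) < p"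
    using not_less_Least[of "?k - 1" "\<lambda>k. p \<le> 2 * psum ns k"] by (auto simp: interval_label_def)
  then show "?k \<in> {1..r}" "p \<in> {2 * psum ns (?k - 1) + 1..2 * psum ns ?k}" using up pos by auto
qed

lemma interval_label_fibre:
  assumes "k \<in> {1..r}"
  shows "{1..2 * psum ns r} \<inter> interval_label ns -` {k} = {2 * psum ns (k - 1) + 1..2 * psum ns k}"
proof (intro equalityI subsetI)
  fix p assume "p \<in> {1..2 * psum ns r} \<inter> interval_label ns -` {k}"
  then show "p \<in> {2 * psum ns (k - 1) + 1..2 * psum ns k}" using interval_label_bounds(2)[of p ns r] by auto
next
  fix p assume p: "p \<in> {2 * psum ns (k - 1) + 1..2 * psum ns k}"
  then have "interval_label ns p = k" by (intro interval_label_eqI) auto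
  moreover have "p \<le> 2 * psum ns r" using p psum_mono[of k r ns] assms by auto
  ultimately show "p \<in> {1..2 * psum ns r} \<inter> interval_label ns -` {k}" using p by auto
qed

lemma prod_of_cycles_outside: "x \<notin> (\<Union>cs\<in>set css. set cs) \<Longrightarrow> prod_of_cycles css x = x"
  by (induction css) (auto simp: prod_of_cycles_def id_outside_supp)

lemma prod_of_cycles_Cons: "prod_of_cycles (cs # css) x = cycle_of_list cs (prod_of_cycles css x)"
  by (simp add: prod_of_cycles_def)

lemma prod_of_cycles_permutes: "prod_of_cycles css permutes (\<Union>cs\<in>set css. set cs)"
proof (induction css)
  case (Cons cs css)
  have "cycle_of_list cs permutes (\<Union>cs\<in>set (cs # css). set cs)"
    by (rule permutes_subset[OF cycle_permutes]) auto
  moreover have "prod_of_cycles css permutes (\<Union>cs\<in>set (cs # css). set cs)"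
    by (rule permutes_subset[OF Cons.IH]) auto
  moreover have "prod_of_cycles (cs # css) = cycle_of_list cs \<circ> prod_of_cycles css"
    by (simp add: prod_of_cycles_def)
  ultimately show ?case by (simp only: permutes_compose)
qed (simp add: prod_of_cycles_def id_def)

lemma prod_of_cycles_inside:
  assumes "sorted_wrt (\<lambda>cs cs'. set cs \<inter> set cs' = {}) css" "cs \<in> set css" "x \<in> set cs"
  shows "prod_of_cycles css x = cycle_of_list cs x"
  using assms
proof (induction css)
  case (Cons c css)
  show ?case
  proof (cases "cs = c")
    case True
    then have "x \<notin> (\<Union>cs\<in>set css. set cs)" using Cons.prems by auto
    then show ?thesis using True by (simp add: prod_of_cycles_Cons prod_of_cycles_outside)
  next
    case False
    then have "cs \<in> set css" "prod_of_cycles css x = cycle_of_list cs x" using Cons by auto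
    moreover have "cycle_of_list cs x \<in> set cs"
      using Cons.prems permutes_in_image[OF cycle_permutes[of cs]] by simp
    ultimately show ?thesis using Cons.prems by (auto simp: prod_of_cycles_Cons intro!: id_outside_supp)
  qed
qed simp

text \<open>
  Relabelling along \<open>p \<mapsto> - p\<close> is how \<open>\<gamma>\<^sub>-\<close> arises from \<open>\<gamma>\<close>.
\<close>
lemma cycle_of_list_map_inj:
  assumes "inj h"
  shows "cycle_of_list (map h cs) (h x) = h (cycle_of_list cs x)"
  by (induction cs arbitrary: x rule: cycle_of_list.induct)
    (auto simp: Transposition.transpose_def inj_eq[OF assms])

lemma prod_of_cycles_map_inj:
  assumes "inj h"
  shows "prod_of_cycles (map (map h) css) (h x) = h (prod_of_cycles css x)"
  by (induction css) (auto simp: prod_of_cycles_def cycle_of_list_map_inj[OF assms])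

lemma cycle_of_list_upt:
  assumes "a \<le> p" "p < b"
  shows "cycle_of_list [a..<b] p = (if Suc p = b then a else Suc p)"
proof -
  let ?j = "p - a"
  have "map (cycle_of_list [a..<b]) [a..<b] ! ?j = rotate1 [a..<b] ! ?j"
    using cyclic_rotation[of "[a..<b]" 1] by simp
  then have "cycle_of_list [a..<b] p = [a..<b] ! (Suc ?j mod (b - a))"
    using assms by (simp add: nth_rotate1)
  moreover have "Suc ?j mod (b - a) = (if Suc p = b then 0 else Suc p - a)"
    using assms by (auto simp: Suc_diff_le)
  ultimately show ?thesis using assms by (auto split: if_splits)
qed

context
  fixes r :: nat and ns :: "nat \<Rightarrow> nat"
begin

lemma gamma_interval:
  assumes "k \<in> {1..r}" "p \<in> {2 * psum ns (k - 1) + 1..2 * psum ns k}"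
  shows "gamma r ns p = (if p = 2 * psum ns k then 2 * psum ns (k - 1) + 1 else Suc p)"
proof -
  have "sorted_wrt (\<lambda>cs cs'. set cs \<inter> set cs' = {}) (map (interval_cycle ns) [1..<Suc r])"
    unfolding sorted_wrt_map
  proof (rule sorted_wrt_mono_rel[OF _ sorted_wrt_upt])
    fix j k :: nat assume "j < k"
    then have "psum ns j \<le> psum ns (k - 1)" by (intro psum_mono) auto
    then show "set (interval_cycle ns j) \<inter> set (interval_cycle ns k) = {}"
      by (auto simp: interval_cycle_def)
  qed
  then have "gamma r ns p = cycle_of_list (interval_cycle ns k) p"
    unfolding gamma_def using assms
    by (intro prod_of_cycles_inside) (auto simp: interval_cycle_def simp del: upt_Suc)
  then show ?thesis using assms unfolding interval_cycle_def by (subst (asm) cycle_of_list_upt) auto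
qed

lemma gamma_label:
  assumes "p \<in> {1..2 * psum ns r}"
  shows "interval_label ns (gamma r ns p) = interval_label ns p" "odd (gamma r ns p) \<longleftrightarrow> even p"
proof -
  let ?k = "interval_label ns p"
  note k = interval_label_bounds[OF assms]
  note g = gamma_interval[OF k]
  have "gamma r ns p \<in> {2 * psum ns (?k - 1) + 1..2 * psum ns ?k}" using g k by auto
  then show "interval_label ns (gamma r ns p) = ?k" by (intro interval_label_eqI) auto
  show "odd (gamma r ns p) \<longleftrightarrow> even p"
  proof (cases "p = 2 * psum ns ?k")
    case True
    then have "even p" by (metis dvd_triv_left)
    then show ?thesis using g True by simp
  qed (use g in simp)
qed

lemma gamma_permutes: "gamma r ns permutes {1..2 * psum ns r}"
proof -
  have "(\<Union>cs\<in>set (map (interval_cycle ns) [1..<Suc r]). set cs) = {1..2 * psum ns r}"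
  proof -
    have "p \<in> {1..2 * psum ns r}"
      if "k \<in> {1..r}" "p \<in> {2 * psum ns (k - 1) + 1..2 * psum ns k}" for k p
      using that interval_label_fibre[OF that(1), of ns] by auto
    moreover have "\<exists>k\<in>{1..r}. p \<in> {2 * psum ns (k - 1) + 1..2 * psum ns k}"
      if "p \<in> {1..2 * psum ns r}" for p
      using interval_label_bounds[OF that] by blast
    ultimately have "(\<Union>k\<in>{1..r}. {2 * psum ns (k - 1) + 1..2 * psum ns k}) = {1..2 * psum ns r}" by blast
    moreover have "set (interval_cycle ns k) = {2 * psum ns (k - 1) + 1..2 * psum ns k}" for k
      by (simp add: interval_cycle_def atLeastLessThanSuc_atLeastAtMost del: upt_Suc)
    ultimately show ?thesis by (simp add: atLeastLessThanSuc_atLeastAtMost del: upt_Suc)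
  qed
  then show ?thesis
    using prod_of_cycles_permutes[of "map (interval_cycle ns) [1..<Suc r]"] by (simp add: gamma_def)
qed

lemma gamma_funpow:
  assumes "k \<in> {1..r}" "2 * psum ns (k - 1) + 1 \<le> p" "p + i \<le> 2 * psum ns k"
  shows "(gamma r ns ^^ i) p = p + i"
  using assms(3)
proof (induction i)
  case (Suc i)
  then show ?case using gamma_interval[OF assms(1), of "p + i"] assms(2) by simp
qed simp

lemma gamma_reaches:
  assumes "p \<in> {1..2 * psum ns r}" "q \<in> {1..2 * psum ns r}" "interval_label ns p = interval_label ns q"
  shows "\<exists>i. (gamma r ns ^^ i) p = q"
proof -
  let ?k = "interval_label ns p"
  let ?a = "2 * psum ns (?k - 1) + 1" and ?b = "2 * psum ns ?k"
  note k = interval_label_bounds[OF assms(1)] interval_label_bounds[OF assms(2), folded assms(3)]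
  \<comment> \<open>go up to the end of the interval, wrap around, and go up to \<open>q\<close>\<close>
  have "(gamma r ns ^^ (?b - p)) p = ?b" using gamma_funpow[OF k(1), of p "?b - p"] k by simp
  moreover have "gamma r ns ?b = ?a" using gamma_interval[OF k(1), of ?b] k by auto
  moreover have "(gamma r ns ^^ (q - ?a)) ?a = q" using gamma_funpow[OF k(1), of ?a "q - ?a"] k by simp
  ultimately have "(gamma r ns ^^ ((q - ?a) + Suc (?b - p))) p = q"
    by (simp only: funpow_add funpow.simps comp_apply)
  then show ?thesis by blast
qed

lemma gamma_minus_neg: "gamma_minus r ns (- int p) = - int (gamma r ns p)"
  using prod_of_cycles_map_inj[of "\<lambda>j. - int j" "map (interval_cycle ns) [1..<Suc r]" p]
  by (simp add: gamma_minus_def gamma_def inj_def comp_def)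

lemma gamma_minus_nonneg: "x > 0 \<Longrightarrow> gamma_minus r ns x = x"
  unfolding gamma_minus_def by (rule prod_of_cycles_outside) auto

lemma inj_gamma_minus: "inj (gamma_minus r ns)"
  unfolding gamma_minus_def by (rule permutes_inj[OF prod_of_cycles_permutes])

end

section \<open>Expansion of the traces\<close>

text \<open>
  A pair \<open>z\<close> is (row, column) of an entry of \<open>X\<close>. The matrix \<open>D p\<close> is contracted along rows of \<open>X\<close>
  for odd \<open>p\<close> and along columns for even \<open>p\<close>, so that \<open>coordinate (odd p)\<close> selects its index.
\<close>

definition coordinate :: "bool \<Rightarrow> 'a \<times> 'a \<Rightarrow> 'a" where
  "coordinate c z = (if c then fst z else snd z)"
lemma prod_in_pairs:
  fixes h :: "nat \<Rightarrow> 'a::comm_monoid_mult"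
  assumes "u \<le> v"
  shows "(\<Prod>m\<in>{2 * u..<2 * v}. h m) = (\<Prod>p\<in>{u + 1..v}. h (2 * p - 2) * h (2 * p - 1))"
  using assms
proof (induction v rule: dec_induct)
  case (step v)
  then show ?case by (simp add: mult.assoc)
qed simp

lemma concat_blocks_of_four:
  "concat (map (\<lambda>j. [g (4 * j), g (4 * j + 1), g (4 * j + 2), g (4 * j + 3)]) [a..<b]) = map g [4 * a..<4 * b]"
proof (induction b)
  case (Suc b)
  have "[4 * b..<4 * b + 4] = [4 * b, 4 * b + 1, 4 * b + 2, 4 * b + 3]"
    by (simp add: upt_conv_Cons eval_nat_numeral)
  then have "a \<le> b \<Longrightarrow> [4 * a..<4 * Suc b] = [4 * a..<4 * b] @ [4 * b, 4 * b + 1, 4 * b + 2, 4 * b + 3]"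
    using upt_add_eq_append[of "4 * a" "4 * b" 4] by (simp add: add.commute)
  then show ?case using Suc by (cases "a \<le> b") auto
qed simp

text \<open>
  The letters are numbered by \<open>m \<in> {4a..<4b}\<close>; the factor \<open>X\<close> or its transpose at position \<open>p\<close> is the
  letter \<open>2p - 2\<close>, and \<open>D p\<close> is the letter \<open>2p - 1\<close>. An index of the expanded trace sits in front of
  every letter. It is a row index of \<open>X\<close> precisely if \<open>m mod 4 \<in> {1, 2}\<close>, which is the predicate
  \<open>row\<close> of the proof, and the two indices around the factor \<open>X\<close> at \<open>p\<close> make up \<open>e p\<close>.
\<close>
lemma trace_alternating_word:
  fixes X :: "real mat" and D :: "nat \<Rightarrow> real mat"
  assumes "a < b" and X: "X \<in> carrier_mat M N"
    and D: "\<And>p. p \<in> {2 * a + 1..2 * b} \<Longrightarrow> odd p \<Longrightarrow> D p \<in> carrier_mat M M"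
      "\<And>p. p \<in> {2 * a + 1..2 * b} \<Longrightarrow> even p \<Longrightarrow> D p \<in> carrier_mat N N"
    and nx: "\<And>p. p \<in> {2 * a + 1..2 * b} \<Longrightarrow> nx p = (if p = 2 * b then 2 * a + 1 else Suc p)"
  shows "mat_trace (mat_prod (concat (map (\<lambda>j. [transpose_mat X, D (2 * j + 1), X, D (2 * j + 2)]) [a..<b]))) =
    (\<Sum>e\<in>PiE {2 * a + 1..2 * b} (\<lambda>_. {..<M} \<times> {..<N}). \<Prod>p\<in>{2 * a + 1..2 * b}.
      X $$ e p * D p $$ (coordinate (odd p) (e p), coordinate (odd p) (e (nx p))))"
proof -
  let ?P = "{2 * a + 1..2 * b}" and ?m = "{4 * a..<4 * b}"
  define g where "g m = (if odd m then D (m div 2 + 1) else if even (m div 2) then transpose_mat X else X)" for m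
  define row where "row m \<longleftrightarrow> odd (m div 2) \<noteq> odd m" for m :: nat
  define d where "d m = (if row m then M else N)" for m
  define nxt where "nxt m = (if Suc m = 4 * b then 4 * a else Suc m)" for m
  have word: "concat (map (\<lambda>j. [transpose_mat X, D (2 * j + 1), X, D (2 * j + 2)]) [a..<b]) = map g [4 * a..<4 * b]"
  proof -
    have "[transpose_mat X, D (2 * j + 1), X, D (2 * j + 2)] =
        [g (4 * j), g (4 * j + 1), g (4 * j + 2), g (4 * j + 3)]" for j
    proof -
      have "(4 * j) div 2 = 2 * j" "(4 * j + 1) div 2 = 2 * j" "(4 * j + 2) div 2 = 2 * j + 1" "(4 * j + 3) div 2 = 2 * j + 1"
        by linarith+
      then show ?thesis by (simp add: g_def)
    qed
    then show ?thesis using concat_blocks_of_four[of g a b] by simp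
  qed
  have even_slot: "(2 * p - 2) div 2 = p - 1" "(2 * p - 1) div 2 = p - 1" if "p \<in> ?P" for p
    using that by auto
  have row_slot: "row (2 * p - 2) \<longleftrightarrow> even p" "row (2 * p - 1) \<longleftrightarrow> odd p" if "p \<in> ?P" for p
    using that even_slot[OF that] by (auto simp: row_def)
  have car: "g m \<in> carrier_mat (d m) (d (nxt m))" if m: "m \<in> ?m" for m
  proof (cases "even m")
    case True
    then have "Suc m \<noteq> 4 * b" by presburger
    then show ?thesis using True X by (auto simp: g_def d_def row_def nxt_def)
  next
    case False
    define p where "p = m div 2 + 1"
    have mp: "m = 2 * p - 1" "p \<in> ?P" using False m by (auto simp: p_def elim!: oddE)
    have "row (nxt m) \<longleftrightarrow> odd p"
    proof (cases "p = 2 * b")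
      case True
      then show ?thesis using mp m by (auto simp: nxt_def row_def)
    next
      case False
      then have "nxt m = 2 * p" using mp by (auto simp: nxt_def)
      then show ?thesis by (simp add: row_def)
    qed
    moreover have "row m \<longleftrightarrow> odd p" using row_slot(2)[OF mp(2)] mp(1) by simp
    moreover have "g m = D p" using False by (simp add: g_def p_def)
    ultimately show ?thesis using D[OF mp(2)] by (auto simp: d_def)
  qed
  have "mat_trace (mat_prod (map g [4 * a..<4 * b])) =
      (\<Sum>i\<in>PiE ?m (\<lambda>m. {..<d m}). \<Prod>m\<in>?m. g m $$ (i m, i (nxt m)))"
  proof -
    have "4 * a < 4 * b" using assms(1) by simp
    then have "[4 * a..<4 * b] \<noteq> []" "distinct [4 * a..<4 * b]" by auto
    moreover have "nxt ([4 * a..<4 * b] ! j) = [4 * a..<4 * b] ! (Suc j mod length [4 * a..<4 * b])"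
      if j: "j < length [4 * a..<4 * b]" for j
      using j by (cases "Suc j = 4 * b - 4 * a") (auto simp: nxt_def)
    moreover have "g m \<in> carrier_mat (d m) (d (nxt m))" if "m \<in> set [4 * a..<4 * b]" for m
      using car that by simp
    ultimately show ?thesis using mat_trace_mat_prod[of "[4 * a..<4 * b]" nxt g d] by simp
  qed
  also have "\<dots> = (\<Sum>i\<in>PiE ?m (\<lambda>m. {..<d m}). \<Prod>p\<in>?P.
      g (2 * p - 2) $$ (i (2 * p - 2), i (2 * p - 1)) * g (2 * p - 1) $$ (i (2 * p - 1), i (nxt (2 * p - 1))))"
  proof (rule sum.cong[OF refl])
    fix i
    have "(\<Prod>m\<in>?m. g m $$ (i m, i (nxt m))) = (\<Prod>p\<in>?P.
        g (2 * p - 2) $$ (i (2 * p - 2), i (nxt (2 * p - 2))) * g (2 * p - 1) $$ (i (2 * p - 1), i (nxt (2 * p - 1))))"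
      using prod_in_pairs[of "2 * a" "2 * b" "\<lambda>m. g m $$ (i m, i (nxt m))"] assms(1) by simp
    moreover have "nxt (2 * p - 2) = 2 * p - 1" if "p \<in> ?P" for p
      using that by (auto simp: nxt_def)
    ultimately show "(\<Prod>m\<in>?m. g m $$ (i m, i (nxt m))) = (\<Prod>p\<in>?P.
        g (2 * p - 2) $$ (i (2 * p - 2), i (2 * p - 1)) * g (2 * p - 1) $$ (i (2 * p - 1), i (nxt (2 * p - 1))))"
      by simp
  qed
  also have "\<dots> = (\<Sum>e\<in>PiE ?P (\<lambda>_. {..<M} \<times> {..<N}). \<Prod>p\<in>?P.
      X $$ e p * D p $$ (coordinate (odd p) (e p), coordinate (odd p) (e (nx p))))"
  proof (rule sum.reindex_bij_witness[where
        i = "\<lambda>e. \<lambda>m\<in>?m. coordinate (row m) (e (m div 2 + 1))" and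
        j = "\<lambda>i. \<lambda>p\<in>?P. if odd p then (i (2 * p - 1), i (2 * p - 2)) else (i (2 * p - 2), i (2 * p - 1))"])
    fix i assume i: "i \<in> PiE ?m (\<lambda>m. {..<d m})"
    let ?e = "\<lambda>p\<in>?P. if odd p then (i (2 * p - 1), i (2 * p - 2)) else (i (2 * p - 2), i (2 * p - 1))"
    have mem: "2 * p - 2 \<in> ?m" "2 * p - 1 \<in> ?m" if "p \<in> ?P" for p using that by auto
    have coord: "coordinate (row (2 * p - 2)) (?e p) = i (2 * p - 2)" "coordinate (row (2 * p - 1)) (?e p) = i (2 * p - 1)"
      if "p \<in> ?P" for p
      using that row_slot[OF that] by (auto simp: coordinate_def)
    show "(\<lambda>m\<in>?m. coordinate (row m) (?e (m div 2 + 1))) = i"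
    proof
      fix m show "(\<lambda>m\<in>?m. coordinate (row m) (?e (m div 2 + 1))) m = i m"
      proof (cases "m \<in> ?m")
        case True
        define p where "p = m div 2 + 1"
        have p: "p \<in> ?P" using True by (auto simp: p_def)
        have "m = 2 * p - 2 \<or> m = 2 * p - 1" by (auto simp: p_def)
        then have "coordinate (row m) (?e p) = i m" by (elim disjE) (simp_all only: coord[OF p])
        then show ?thesis using True by (simp only: restrict_apply if_True p_def)
      next
        case False
        then show ?thesis using PiE_arb[OF i False] by (simp only: restrict_apply if_False)
      qed
    qed
    show "?e \<in> PiE ?P (\<lambda>_. {..<M} \<times> {..<N})"
    proof (rule restrict_PiE_iff[THEN iffD2], rule ballI)
      fix p assume p: "p \<in> ?P"
      then show "(if odd p then (i (2 * p - 1), i (2 * p - 2)) else (i (2 * p - 2), i (2 * p - 1))) \<in> {..<M} \<times> {..<N}"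
        using PiE_mem[OF i mem(1)[OF p]] PiE_mem[OF i mem(2)[OF p]] row_slot[OF p] by (auto simp: d_def)
    qed
    show "(\<Prod>p\<in>?P. X $$ ?e p * D p $$ (coordinate (odd p) (?e p), coordinate (odd p) (?e (nx p)))) =
      (\<Prod>p\<in>?P. g (2 * p - 2) $$ (i (2 * p - 2), i (2 * p - 1)) * g (2 * p - 1) $$ (i (2 * p - 1), i (nxt (2 * p - 1))))"
    proof (rule prod.cong[OF refl])
      fix p assume p: "p \<in> ?P"
      have bd: "i (2 * p - 2) < d (2 * p - 2)" "i (2 * p - 1) < d (2 * p - 1)"
        using PiE_mem[OF i mem(1)[OF p]] PiE_mem[OF i mem(2)[OF p]] by auto
      have "g (2 * p - 2) $$ (i (2 * p - 2), i (2 * p - 1)) = X $$ ?e p"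
        using p bd X row_slot[OF p] even_slot[OF p] by (auto simp: g_def d_def)
      moreover have "g (2 * p - 1) = D p" using p even_slot[OF p] by (auto simp: g_def)
      moreover have "i (2 * p - 1) = coordinate (odd p) (?e p)"
        using coord(2)[OF p] row_slot(2)[OF p] by simp
      moreover have "i (nxt (2 * p - 1)) = coordinate (odd p) (?e (nx p))"
      proof -
        have q: "nx p \<in> ?P" "odd (nx p) \<longleftrightarrow> even p" using nx[OF p] p assms(1) by auto
        have "nxt (2 * p - 1) = 2 * nx p - 2" using p by (auto simp: nx[OF p] nxt_def)
        moreover have "row (2 * nx p - 2) = odd p" using row_slot(1)[OF q(1)] q(2) by blast
        ultimately show ?thesis using coord(1)[OF q(1)] by (simp only:)
      qed
      ultimately show "X $$ ?e p * D p $$ (coordinate (odd p) (?e p), coordinate (odd p) (?e (nx p))) =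
        g (2 * p - 2) $$ (i (2 * p - 2), i (2 * p - 1)) * g (2 * p - 1) $$ (i (2 * p - 1), i (nxt (2 * p - 1)))"
        by simp
    qed
  next
    fix e assume e: "e \<in> PiE ?P (\<lambda>_. {..<M} \<times> {..<N})"
    let ?i = "\<lambda>m\<in>?m. coordinate (row m) (e (m div 2 + 1))"
    have *: "?i (2 * p - 2) = coordinate (even p) (e p)" "?i (2 * p - 1) = coordinate (odd p) (e p)" if "p \<in> ?P" for p
      using that row_slot[OF that] even_slot[OF that] by auto
    show "(\<lambda>p\<in>?P. if odd p then (?i (2 * p - 1), ?i (2 * p - 2)) else (?i (2 * p - 2), ?i (2 * p - 1))) = e"
    proof
      fix p show "(\<lambda>p\<in>?P. if odd p then (?i (2 * p - 1), ?i (2 * p - 2)) else (?i (2 * p - 2), ?i (2 * p - 1))) p = e p"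
      proof (cases "p \<in> ?P")
        case True
        then show ?thesis unfolding restrict_apply[of _ ?P] if_P[OF True] *[OF True] by (auto simp: coordinate_def)
      next
        case False
        then show ?thesis using PiE_arb[OF e False] by (simp only: restrict_apply if_False)
      qed
    qed
    show "?i \<in> PiE ?m (\<lambda>m. {..<d m})"
    proof (rule restrict_PiE_iff[THEN iffD2], rule ballI)
      fix m assume "m \<in> ?m"
      then have "m div 2 + 1 \<in> ?P" by auto
      then show "coordinate (row m) (e (m div 2 + 1)) \<in> {..<d m}"
        using PiE_mem[OF e, of "m div 2 + 1"] by (auto simp: coordinate_def d_def mem_Times_iff)
    qed
  qed
  finally show ?thesis unfolding word .
qed

text \<open>
  The exponent of \<open>N\<close> collects \<open>2 ns k\<close> factors \<open>1 / sqrt N\<close> from the entries of \<open>X\<close> and one factor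
  \<open>1 / N\<close> from the normalised trace.
\<close>
lemma Y_expansion:
  fixes f :: "nat \<Rightarrow> nat \<Rightarrow> 'a \<Rightarrow> real" and D :: "nat \<Rightarrow> real mat"
  assumes "N > 0" "k \<in> {1..r}" "ns k > 0"
    and D: "\<And>p. p \<in> {1..2 * psum ns r} \<Longrightarrow> odd p \<Longrightarrow> D p \<in> carrier_mat M M"
      "\<And>p. p \<in> {1..2 * psum ns r} \<Longrightarrow> even p \<Longrightarrow> D p \<in> carrier_mat N N"
  defines "V \<equiv> {1..2 * psum ns r} \<inter> interval_label ns -` {k}"
  shows "Y M N f ns D k \<omega> = (\<Sum>e\<in>PiE V (\<lambda>_. {..<M} \<times> {..<N}).
    ((\<Prod>p\<in>V. D p $$ (coordinate (odd p) (e p), coordinate (odd p) (e (gamma r ns p)))) / real N ^ (ns k + 1)) *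
    (\<Prod>p\<in>V. case_prod f (e p) \<omega>))"
proof -
  let ?a = "psum ns (k - 1)" and ?b = "psum ns k"
  let ?X = "gaussian_matrix M N f \<omega>"
  let ?D = "\<lambda>e p. D p $$ (coordinate (odd p) (e p), coordinate (odd p) (e (gamma r ns p)))"
  have V: "V = {2 * ?a + 1..2 * ?b}" unfolding V_def using assms(2) by (rule interval_label_fibre)
  have b: "?b = ?a + ns k" using assms(2) by (intro psum_rec) auto
  have card: "card V = 2 * ns k" by (simp add: V b)
  have sub: "V \<subseteq> {1..2 * psum ns r}" by (auto simp: V_def)
  have X: "?X \<in> carrier_mat M N" by (simp add: gaussian_matrix_def)
  have "mat_trace (mat_prod (Y_word ns ?X D k)) =
      (\<Sum>e\<in>PiE V (\<lambda>_. {..<M} \<times> {..<N}). \<Prod>p\<in>V. ?X $$ e p * ?D e p)"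
    unfolding Y_word_def V
  proof (rule trace_alternating_word[OF _ X])
    show "?a < ?b" using b assms(3) by simp
    show "gamma r ns p = (if p = 2 * ?b then 2 * ?a + 1 else Suc p)" if "p \<in> {2 * ?a + 1..2 * ?b}" for p
      using assms(2) that by (rule gamma_interval)
  qed (use D sub V in auto)
  also have "\<dots> = (\<Sum>e\<in>PiE V (\<lambda>_. {..<M} \<times> {..<N}).
      (\<Prod>p\<in>V. ?D e p) / real N ^ ns k * (\<Prod>p\<in>V. case_prod f (e p) \<omega>))"
  proof (rule sum.cong[OF refl])
    fix e assume e: "e \<in> PiE V (\<lambda>_. {..<M} \<times> {..<N})"
    have "(\<Prod>p\<in>V. ?X $$ e p) = (\<Prod>p\<in>V. case_prod f (e p) \<omega> / sqrt (real N))"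
    proof (rule prod.cong[OF refl])
      fix p assume "p \<in> V"
      then have "e p \<in> {..<M} \<times> {..<N}" using e by auto
      then show "?X $$ e p = case_prod f (e p) \<omega> / sqrt (real N)"
        by (cases "e p") (simp add: gaussian_matrix_def)
    qed
    also have "\<dots> = (\<Prod>p\<in>V. case_prod f (e p) \<omega>) / real N ^ ns k"
      by (simp add: prod_dividef card power_mult)
    finally show "(\<Prod>p\<in>V. ?X $$ e p * ?D e p) = (\<Prod>p\<in>V. ?D e p) / real N ^ ns k * (\<Prod>p\<in>V. case_prod f (e p) \<omega>)"
      by (simp add: prod.distrib)
  qed
  finally show ?thesis
    unfolding Y_def by (simp only: sum_divide_distrib) (simp add: mult.commute[of "real N"])
qed

section \<open>Pairings as permutations, and transitivity\<close>

lemma pairing_perm_eqI: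
  assumes "\<pi> \<in> pairings_on V" "{p, q} \<in> \<pi>" "p \<noteq> q"
  shows "pairing_perm \<pi> p = q"
proof -
  have "(THE l. l \<noteq> p \<and> {p, l} \<in> \<pi>) = q"
  proof (rule the_equality)
    fix l assume l: "l \<noteq> p \<and> {p, l} \<in> \<pi>"
    have "disjoint \<pi>" using assms(1) by (simp add: pairings_on_def partition_on_def)
    then have "{p, l} = {p, q}" using disjointD[of \<pi> "{p, l}" "{p, q}"] l assms(2) by blast
    then show "l = q" using assms(3) l by (simp add: doubleton_eq_iff)
  qed (use assms in auto)
  then show ?thesis using assms(2) by (auto simp: pairing_perm_def)
qed

lemma pairing_perm_block:
  assumes "\<pi> \<in> pairings_on V" "p \<in> V"
  shows "{p, pairing_perm \<pi> p} \<in> \<pi>" "pairing_perm \<pi> p \<noteq> p"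
    and "pairing_perm \<pi> p \<in> V" "pairing_perm \<pi> (pairing_perm \<pi> p) = p"
proof -
  obtain b where b: "b \<in> \<pi>" "p \<in> b" using assms by (auto simp: pairings_on_def partition_on_def)
  moreover have "card b = 2" using assms b by (auto simp: pairings_on_def)
  ultimately obtain q where q: "{p, q} \<in> \<pi>" "p \<noteq> q" by (auto simp: card_2_iff insert_commute)
  then have eq: "pairing_perm \<pi> p = q" by (rule pairing_perm_eqI[OF assms(1)])
  show "{p, pairing_perm \<pi> p} \<in> \<pi>" "pairing_perm \<pi> p \<noteq> p" using q eq by auto
  show "pairing_perm \<pi> p \<in> V" using q eq assms(1) by (auto simp: pairings_on_def partition_on_def)
  show "pairing_perm \<pi> (pairing_perm \<pi> p) = p"
    unfolding eq using pairing_perm_eqI[OF assms(1), of q p] q by (simp add: insert_commute)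
qed

lemma pairing_perm_permutes:
  assumes "\<pi> \<in> pairings_on V" "finite V"
  shows "pairing_perm \<pi> permutes V"
proof (rule bij_imp_permutes)
  show "bij_betw (pairing_perm \<pi>) V V"
    using pairing_perm_block[OF assms(1)]
    by (intro bij_betw_byWitness[where f' = "pairing_perm \<pi>"]) auto
  show "pairing_perm \<pi> x = x" if "x \<notin> V" for x
    using that assms(1) by (auto simp: pairing_perm_def pairings_on_def partition_on_def)
qed

lemma prod_of_bool: "finite A \<Longrightarrow> (\<Prod>x\<in>A. of_bool (Q x)) = (of_bool (\<forall>x\<in>A. Q x) :: real)"
  by (induction A rule: finite_induct) simp_all

lemma prod_matched:
  assumes "\<pi> \<in> pairings_on V" "finite V"
  shows "(\<Prod>b\<in>\<pi>. matched e b) = of_bool (\<forall>p\<in>V. e (pairing_perm \<pi> p) = e p)"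
proof -
  have "(\<forall>b\<in>\<pi>. \<forall>x\<in>b. \<forall>y\<in>b. e x = e y) \<longleftrightarrow> (\<forall>p\<in>V. e (pairing_perm \<pi> p) = e p)"
  proof (intro iffI ballI)
    fix p assume "\<forall>b\<in>\<pi>. \<forall>x\<in>b. \<forall>y\<in>b. e x = e y" "p \<in> V"
    then show "e (pairing_perm \<pi> p) = e p" using pairing_perm_block(1)[OF assms(1), of p] by (meson insertCI)
  next
    fix b x y assume h: "\<forall>p\<in>V. e (pairing_perm \<pi> p) = e p" "b \<in> \<pi>" "x \<in> b" "y \<in> b"
    have xV: "x \<in> V" and "card b = 2" using h assms(1) by (auto simp: pairings_on_def partition_on_def)
    show "e x = e y"
    proof (cases "x = y")
      case False
      then have "b = {x, y}" using \<open>card b = 2\<close> h(3,4) by (auto simp: card_2_iff)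
      then have "pairing_perm \<pi> x = y" using pairing_perm_eqI[OF assms(1), of x y] False h(2) by simp
      then show ?thesis using h(1) xV by auto
    qed simp
  qed
  moreover have "(\<Prod>b\<in>\<pi>. matched e b) = of_bool (\<forall>b\<in>\<pi>. \<forall>x\<in>b. \<forall>y\<in>b. e x = e y)"
    unfolding matched_def by (rule prod_of_bool[OF finite_pairing[OF assms(2,1)]])
  ultimately show ?thesis by simp
qed

text \<open>
  A permutation that maps a finite set into itself maps it onto itself, so its inverse does as well.
\<close>
lemma generate_preserves:
  assumes "g \<in> generate (sym_group m) H"
    and "\<And>h. h \<in> H \<Longrightarrow> h permutes {1..m}" "\<And>h. h \<in> H \<Longrightarrow> h ` W \<subseteq> W"
    and "W \<subseteq> {1..m}"
  shows "g ` W \<subseteq> W"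
  using assms(1)
proof (induction rule: generate.induct)
  case (inv h)
  have "finite W" using assms(4) finite_subset by blast
  have h: "h permutes {1..m}" "inj h" using assms(2)[OF inv] permutes_inj by auto
  then have "h ` W = W"
    using assms(3)[OF inv] \<open>finite W\<close> by (intro endo_inj_surj) (auto simp: inj_on_def inj_def)
  then have "inv' h ` W \<subseteq> W" using h by (metis image_inv_f_f order_refl)
  moreover have "inv\<^bsub>sym_group m\<^esub> h = inv' h"
    using h(1) by (intro sym_group_inv_equality) (simp add: sym_group_carrier)
  ultimately show ?case by simp
qed (use assms(3) in \<open>auto simp: sym_group_def\<close>)

text \<open>
  An invariant set of positions is, by invariance under \<open>\<gamma>\<close>, a union of label fibres and, by invariance
  under \<open>\<pi>\<close>, lies over a saturated set of labels. So orbits of the group correspond to components.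
\<close>
lemma transitive_iff_connected_via:
  assumes \<gamma>: "\<gamma> permutes {1..m}" "\<And>p. p \<in> {1..m} \<Longrightarrow> L (\<gamma> p) = L p"
    and reach: "\<And>p q. p \<in> {1..m} \<Longrightarrow> q \<in> {1..m} \<Longrightarrow> L p = L q \<Longrightarrow> \<exists>i. (\<gamma> ^^ i) p = q"
    and \<pi>: "\<pi> \<in> pairings_on {1..m}"
  shows "acts_transitively_on (generate (sym_group m) {\<gamma>, pairing_perm \<pi>}) {1..m} \<longleftrightarrow>
    connected_via L \<pi> (L ` {1..m})"
proof
  let ?\<tau> = "pairing_perm \<pi>" and ?V = "{1..m}"
  let ?G = "generate (sym_group m) {\<gamma>, ?\<tau>}"
  note \<tau> = pairing_perm_block[OF \<pi>] pairing_perm_permutes[OF \<pi> finite_atLeastAtMost]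
  have perm: "h permutes ?V" if "h \<in> {\<gamma>, ?\<tau>}" for h using that \<gamma>(1) \<tau>(5) by auto
  {
    assume tr: "acts_transitively_on ?G ?V"
    show "connected_via L \<pi> (L ` ?V)"
      unfolding connected_via_def
    proof (intro allI impI equalityI)
      fix K assume K: "K \<subseteq> L ` ?V" "K \<noteq> {}" "saturated L \<pi> K"
      let ?W = "?V \<inter> L -` K"
      obtain p where p: "p \<in> ?W" using K by blast
      have pres: "h ` ?W \<subseteq> ?W" if "h \<in> {\<gamma>, ?\<tau>}" for h
      proof -
        have "\<gamma> q \<in> ?W" if "q \<in> ?W" for q using that \<gamma> permutes_in_image[OF \<gamma>(1)] by auto
        moreover have "?\<tau> q \<in> ?W" if "q \<in> ?W" for q
        proof -
          have "{q, ?\<tau> q} \<in> \<pi>" "?\<tau> q \<in> ?V" using that \<tau> by auto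
          then show ?thesis using K(3) that unfolding saturated_def by fastforce
        qed
        ultimately show ?thesis using that by blast
      qed
      show "L ` ?V \<subseteq> K"
      proof
        fix k assume "k \<in> L ` ?V"
        then obtain q where q: "q \<in> ?V" "k = L q" by auto
        then obtain g where g: "g \<in> ?G" "g p = q" using tr p unfolding acts_transitively_on_def by blast
        from g(1) have "g ` ?W \<subseteq> ?W"
          by (rule generate_preserves) (erule perm | erule pres | rule Int_lower1)+
        then have "q \<in> ?W" using p g(2) by blast
        then show "k \<in> K" using q by auto
      qed
    qed (simp add: subset_eq)
  next
    assume conn: "connected_via L \<pi> (L ` ?V)"
    show "acts_transitively_on ?G ?V"
      unfolding acts_transitively_on_def
    proof (intro ballI)
      fix x y assume x: "x \<in> ?V" and y: "y \<in> ?V"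
      define Ob where "Ob = (\<lambda>g. g x) ` ?G"
      have closed: "h z \<in> Ob" if hz: "h \<in> {\<gamma>, ?\<tau>}" "z \<in> Ob" for h z
      proof -
        obtain g where g: "g \<in> ?G" "z = g x" using hz(2) unfolding Ob_def by blast
        have "h \<otimes>\<^bsub>sym_group m\<^esub> g \<in> ?G" by (rule generate.eng[OF generate.incl[OF hz(1)] g(1)])
        then have "(h \<otimes>\<^bsub>sym_group m\<^esub> g) x \<in> Ob" unfolding Ob_def by (rule imageI)
        then show ?thesis using g(2) by (simp add: sym_group_mult)
      qed
      have stable: "h ` ?V \<subseteq> ?V" if "h \<in> {\<gamma>, ?\<tau>}" for h
        using permutes_image[OF perm[OF that]] by blast
      have "g x \<in> ?V" if "g \<in> ?G" for g
      proof -
        have "g ` ?V \<subseteq> ?V" using that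
          by (rule generate_preserves) (erule perm | erule stable | rule order_refl)+
        then show ?thesis using x by blast
      qed
      then have OV: "Ob \<subseteq> ?V" by (auto simp: Ob_def)
      have fibre: "q \<in> Ob" if pq: "p \<in> Ob" "q \<in> ?V" "L p = L q" for p q
      proof -
        obtain i where "(\<gamma> ^^ i) p = q" using reach[OF subsetD[OF OV pq(1)] pq(2,3)] by blast
        moreover have "(\<gamma> ^^ i) p \<in> Ob" for i using closed pq(1) by (induction i) auto
        ultimately show ?thesis by blast
      qed
      have "saturated L \<pi> (L ` Ob)"
        unfolding saturated_def
      proof (intro ballI disjCI)
        fix b assume b: "b \<in> \<pi>" "L ` b \<inter> L ` Ob \<noteq> {}"
        then obtain p z where p: "p \<in> b" "z \<in> Ob" "L z = L p" by force
        have bV: "b \<subseteq> ?V" "card b = 2" using \<pi> b by (auto simp: pairings_on_def partition_on_def)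
        then have pO: "p \<in> Ob" using fibre p by auto
        obtain q where q: "b = {p, q}" "p \<noteq> q" using bV(2) p(1) by (auto simp: card_2_iff)
        then have "?\<tau> p = q" using pairing_perm_eqI[OF \<pi>, of p q] b(1) by simp
        then have "q \<in> Ob" using closed[of ?\<tau> p] pO by auto
        then show "L ` b \<subseteq> L ` Ob" using q pO by auto
      qed
      moreover have "x \<in> Ob"
        unfolding Ob_def using generate.one[of "sym_group m" "{\<gamma>, ?\<tau>}"]
        by (intro image_eqI[where x = id]) (simp_all add: sym_group_one)
      ultimately have "L ` Ob = L ` ?V"
        using conn image_mono[OF OV, of L] unfolding connected_via_def by (metis empty_iff imageI)
      then obtain p where "p \<in> Ob" "L p = L y" using y by (metis imageE imageI)
      then have "y \<in> Ob" using fibre y by auto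
      then show "\<exists>g\<in>?G. g x = y" by (auto simp: Ob_def)
    qed
  }
qed

section \<open>Permutations reversed by negation\<close>

text \<open>
  Expanding each factor gives one index for every element of the cycle, hence one for every element of \<open>S\<close>.
\<close>
lemma Tr_perm_eq_sum:
  assumes "finite S" "\<sigma> permutes S"
    and car: "\<And>x. x \<in> S \<Longrightarrow> signed_mat A x \<in> carrier_mat (d x) (d x)"
    and d: "\<And>x. x \<in> S \<Longrightarrow> d (\<sigma> x) = d x"
  shows "Tr_perm S \<sigma> A = (\<Sum>i\<in>PiE S (\<lambda>x. {..<d x}). \<Prod>x\<in>S. signed_mat A x $$ (i x, i (\<sigma> x)))"
proof -
  have perm: "permutation \<sigma>" using assms(1,2) by (auto simp: permutation_permutes)
  let ?O = "Orbits.orbit \<sigma> ` S"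
  have self: "x \<in> Orbits.orbit \<sigma> x" for x using perm by (rule permutation_self_in_orbit)
  have orb: "C \<subseteq> S" "finite C" "C \<noteq> {}" "\<And>x. x \<in> C \<Longrightarrow> Orbits.orbit \<sigma> x = C" if C: "C \<in> ?O" for C
  proof -
    show "C \<subseteq> S" using C permutes_orbit_subset[OF assms(2)] by auto
    then show "finite C" using assms(1) finite_subset by blast
    show "C \<noteq> {}" using C self by auto
    show "Orbits.orbit \<sigma> x = C" if "x \<in> C" for x
      using C that orbit_cyclic_eq3[OF cyclic_on_orbit'[OF perm]] by auto
  qed
  have un: "(\<Union>C\<in>?O. C) = S" using orb(1) self by auto
  have disj: "C \<inter> C' = {}" if "C \<in> ?O" "C' \<in> ?O" "C \<noteq> C'" for C C'
    using orb(4)[OF that(1)] orb(4)[OF that(2)] that(3) by auto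
  have cyc: "mat_trace (mat_prod (map (signed_mat A) (Cycles.support \<sigma> (Min C)))) =
      (\<Sum>i\<in>PiE C (\<lambda>x. {..<d x}). \<Prod>x\<in>C. signed_mat A x $$ (i x, i (\<sigma> x)))" if C: "C \<in> ?O" for C
  proof -
    let ?xs = "Cycles.support \<sigma> (Min C)" and ?l = "least_power \<sigma> (Min C)"
    note l = least_power_of_permutation[OF perm, of "Min C"]
    have "Orbits.orbit \<sigma> (Min C) = C" using orb(2,3)[OF C] by (intro orb(4)[OF C] Min_in)
    then have "range (\<lambda>i. (\<sigma> ^^ i) (Min C)) = C"
      using orbit_altdef_permutation[OF perm, of "Min C"] by (simp add: full_SetCompr_eq)
    then have set: "set ?xs = C" using support_set[OF perm, of "Min C"] by (simp only:)
    have "mat_trace (mat_prod (map (signed_mat A) ?xs)) =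
        (\<Sum>i\<in>PiE (set ?xs) (\<lambda>x. {..<d x}). \<Prod>x\<in>set ?xs. signed_mat A x $$ (i x, i (\<sigma> x)))"
    proof (rule mat_trace_mat_prod)
      show "?xs \<noteq> []" using l(2) by simp
      show "distinct ?xs" using perm by (rule cycle_of_permutation)
      show "\<sigma> (?xs ! j) = ?xs ! (Suc j mod length ?xs)" if "j < length ?xs" for j
      proof (cases "Suc j = ?l")
        case True
        then have "\<sigma> ((\<sigma> ^^ j) (Min C)) = Min C" using l(1) by (metis comp_apply funpow.simps(2))
        then show ?thesis using that True l(2) by simp
      qed (use that in simp)
      show "signed_mat A x \<in> carrier_mat (d x) (d (\<sigma> x))" if "x \<in> set ?xs" for x
        using that car d orb(1)[OF C] unfolding set by (metis subsetD)
    qed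
    then show ?thesis unfolding set .
  qed
  have "Tr_perm S \<sigma> A = (\<Prod>C\<in>?O. \<Sum>i\<in>PiE C (\<lambda>x. {..<d x}). \<Prod>x\<in>C. signed_mat A x $$ (i x, i (\<sigma> x)))"
    unfolding Tr_perm_def using cyc by (rule prod.cong[OF refl])
  also have "\<dots> = (\<Sum>i\<in>PiE (\<Union>C\<in>?O. C) (\<lambda>x. {..<d x}). \<Prod>C\<in>?O. \<Prod>x\<in>C. signed_mat A x $$ (i x, i (\<sigma> x)))"
  proof (rule sum_PiE_UNION_prod[symmetric])
    fix C i assume C: "C \<in> ?O"
    have "\<sigma> x \<in> C" if "x \<in> C" for x using orb(4)[OF C that] orbit.base[of \<sigma> x] by auto
    then show "(\<Prod>x\<in>C. signed_mat A x $$ (restrict i C x, restrict i C (\<sigma> x))) =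
        (\<Prod>x\<in>C. signed_mat A x $$ (i x, i (\<sigma> x)))" by simp
  qed (use assms(1) orb(2) disj in auto)
  also have "\<dots> = (\<Sum>i\<in>PiE S (\<lambda>x. {..<d x}). \<Prod>x\<in>S. signed_mat A x $$ (i x, i (\<sigma> x)))"
  proof -
    have "(\<Prod>C\<in>?O. \<Prod>x\<in>C. h x) = (\<Prod>x\<in>S. h x)" for h :: "int \<Rightarrow> real"
      using prod.UNION_disjoint[of ?O "\<lambda>C. C" h] assms(1) orb(2) disj un by simp
    then show ?thesis unfolding un by simp
  qed
  finally show ?thesis .
qed

text \<open>
  Negation conjugates \<open>\<sigma>\<close> to its inverse. Hence the negative of a cycle is a cycle run through
  backwards, and the last assumption ensures that it is a different one.
\<close>

locale neg_reversing =
  fixes S :: "int set" and \<sigma> :: "int \<Rightarrow> int"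
  assumes fin: "finite S" and zero: "0 \<notin> S" and neg: "x \<in> S \<Longrightarrow> - x \<in> S"
    and closed: "x \<in> S \<Longrightarrow> \<sigma> x \<in> S"
    and reverses: "x \<in> S \<Longrightarrow> \<sigma> (- \<sigma> x) = - x"
    and neq_neg: "x \<in> S \<Longrightarrow> \<sigma> x \<noteq> - x"
begin

lemma bij_betw_self: "bij_betw \<sigma> S S"
proof (rule bij_betw_imageI)
  have "S \<subseteq> \<sigma> ` S"
  proof
    fix y assume "y \<in> S"
    then have "y = \<sigma> (- \<sigma> (- y))" "- \<sigma> (- y) \<in> S" using reverses[of "- y"] neg closed by auto
    then show "y \<in> \<sigma> ` S" by blast
  qed
  then show "inj_on \<sigma> S" "\<sigma> ` S = S" using fin closed by (auto intro: finite_surj_inj)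
qed

text \<open>
  If \<open>\<sigma>\<^sup>m\<close> maps \<open>x\<close> to \<open>- x\<close>, then \<open>\<sigma>\<^bsup>m-2\<^esup>\<close> maps \<open>\<sigma> x\<close> to \<open>- \<sigma> x\<close>. Descending by two ends at
  \<open>m = 0\<close>, excluded by \<open>0 \<notin> S\<close>, or at \<open>m = 1\<close>, excluded by assumption.
\<close>
lemma funpow_neq_neg: "x \<in> S \<Longrightarrow> (\<sigma> ^^ m) x \<noteq> - x"
proof (induction m arbitrary: x rule: induct_nat_012)
  case 0
  then show ?case using zero by (auto simp: eq_neg_iff_add_eq_0)
next
  case 1
  then show ?case using neq_neg by simp
next
  case (ge2 m)
  have funS: "(\<sigma> ^^ i) z \<in> S" if "z \<in> S" for i z using closed that by (induction i) auto
  show ?case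
  proof
    assume "(\<sigma> ^^ Suc (Suc m)) x = - x"
    then have "\<sigma> ((\<sigma> ^^ m) (\<sigma> x)) = \<sigma> (- \<sigma> x)"
      using reverses[OF ge2.prems] by (simp add: funpow_swap1)
    then have "(\<sigma> ^^ m) (\<sigma> x) = - \<sigma> x"
      using bij_betw_imp_inj_on[OF bij_betw_self] funS closed neg ge2.prems by (auto dest: inj_onD)
    then show False using ge2.IH(1) closed ge2.prems by blast
  qed
qed

lemma self_in_orbit:
  assumes "x \<in> S"
  shows "x \<in> Orbits.orbit \<sigma> x"
proof -
  have "perm_restrict \<sigma> S permutes S"
    using bij_betw_self by (intro bij_imp_permutes) (auto simp: perm_restrict_def cong: bij_betw_cong)
  then have "x \<in> Orbits.orbit (perm_restrict \<sigma> S) x"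
    using fin by (intro permutation_self_in_orbit) (auto simp: permutation_permutes)
  also have "Orbits.orbit (perm_restrict \<sigma> S) x = Orbits.orbit \<sigma> x"
    using assms closed by (intro orbit_cong0) (auto simp: perm_restrict_def)
  finally show ?thesis .
qed

lemma orbit_in_S:
  assumes "x \<in> S" "y \<in> Orbits.orbit \<sigma> x"
  shows "y \<in> S"
  using assms(2) by induction (use closed assms(1) in auto)

lemma neg_orbit:
  assumes "x \<in> S" "y \<in> Orbits.orbit \<sigma> x"
  shows "- y \<in> Orbits.orbit \<sigma> (- x)"
proof -
  have one: "- \<sigma> z \<in> Orbits.orbit \<sigma> (- z)" if "z \<in> S" for z
  proof -
    have "- \<sigma> z \<in> Orbits.orbit \<sigma> (- \<sigma> z)" using that closed neg by (intro self_in_orbit) auto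
    then show ?thesis using self_in_orbit_step[of "- \<sigma> z" \<sigma>] reverses[OF that] by simp
  qed
  show ?thesis
    using assms(2)
  proof induction
    case base
    then show ?case using one assms(1) by simp
  next
    case (step y)
    then show ?case using one[of y] orbit_in_S[OF assms(1)] orbit_trans by fast
  qed
qed

lemma half_domain_step:
  assumes "x \<in> half_domain \<sigma> S"
  shows "\<sigma> x \<in> half_domain \<sigma> S"
proof -
  have x: "x \<in> S" using assms by (simp add: half_domain_def)
  show ?thesis
    using assms closed[OF x] self_in_orbit_step[OF self_in_orbit[OF x]]
    by (simp add: half_domain_def)
qed

text \<open>
  Let \<open>y\<close> have least absolute value in the cycle of \<open>x\<close>. It is unique, as \<open>- y\<close> lies in the cycle of
  \<open>- x\<close>; its sign decides which of the two cycles is particular.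
\<close>
lemma half_domain_complement:
  assumes x: "x \<in> S"
  shows "x \<in> half_domain \<sigma> S \<longleftrightarrow> - x \<notin> half_domain \<sigma> S"
proof -
  let ?O = "Orbits.orbit \<sigma> x" and ?O' = "Orbits.orbit \<sigma> (- x)"
  have neg_O: "- y \<in> ?O' \<longleftrightarrow> y \<in> ?O" for y
    using neg_orbit[OF x] neg_orbit[OF neg[OF x], of "- y"] by auto
  have "finite ?O" "?O \<noteq> {}" using finite_orbit[OF self_in_orbit[OF x]] orbit_nonempty[of \<sigma> x] by auto
  then obtain y where "is_arg_min abs (\<lambda>y. y \<in> ?O) y" using ex_is_arg_min_if_finite by blast
  then have y: "y \<in> ?O" "\<And>z. z \<in> ?O \<Longrightarrow> \<bar>y\<bar> \<le> \<bar>z\<bar>" by (auto simp: is_arg_min_linorder)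
  then have yS: "y \<in> S" using orbit_in_S[OF x] by auto
  have one: "x \<in> half_domain \<sigma> S \<or> - x \<in> half_domain \<sigma> S"
  proof (cases "y > 0")
    case True
    then show ?thesis using x y by (auto simp: half_domain_def)
  next
    case False
    then have "- y > 0" using yS zero by (cases "y = 0") auto
    moreover have "- y \<in> ?O'" using neg_O y by auto
    moreover have "\<bar>- y\<bar> \<le> \<bar>z\<bar>" if "z \<in> ?O'" for z using y(2)[of "- z"] neg_O[of "- z"] that by auto
    ultimately show ?thesis using neg[OF x] unfolding half_domain_def by blast
  qed
  have "False" if both: "x \<in> half_domain \<sigma> S" "- x \<in> half_domain \<sigma> S"
  proof -
    obtain u where u: "u \<in> ?O" "u > 0" "\<forall>z\<in>?O. \<bar>u\<bar> \<le> \<bar>z\<bar>"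
      using both(1) unfolding half_domain_def by blast
    obtain v where v: "v \<in> ?O'" "v > 0" "\<forall>z\<in>?O'. \<bar>v\<bar> \<le> \<bar>z\<bar>"
      using both(2) unfolding half_domain_def by blast
    have "- v \<in> ?O" "- u \<in> ?O'" using neg_O[of "- v"] neg_O[of u] u v by auto
    then have "u = v" using bspec[OF u(3), of "- v"] bspec[OF v(3), of "- u"] u(2) v(2) by auto
    then have "- u \<in> ?O" using \<open>- v \<in> ?O\<close> by simp
    moreover have "?O = Orbits.orbit \<sigma> u"
    proof -
      have "cyclic_on \<sigma> ?O" using self_in_orbit[OF x] by (intro cyclic_on_singleI) auto
      then show ?thesis using u(1) by (rule orbit_cyclic_eq3[symmetric])
    qed
    ultimately have "- u \<in> Orbits.orbit \<sigma> u" by simp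
    then obtain i where "(\<sigma> ^^ i) u = - u" by (auto simp: orbit_altdef)
    then show False using funpow_neq_neg orbit_in_S[OF x u(1)] by blast
  qed
  with one show ?thesis by blast
qed

text \<open>
  The condition \<open>i (- x) = i (\<sigma> x)\<close> expresses the indices outside \<open>H\<close> by those on \<open>H\<close> and is then
  satisfied everywhere, because the conditions at \<open>x\<close> and at \<open>- \<sigma> x\<close> are the same.
\<close>
lemma sum_over_half:
  fixes g :: "int \<Rightarrow> nat \<Rightarrow> nat \<Rightarrow> real"
  assumes HS: "H \<subseteq> S" and step: "\<And>x. x \<in> H \<Longrightarrow> \<sigma> x \<in> H"
    and compl: "\<And>x. x \<in> S \<Longrightarrow> x \<in> H \<longleftrightarrow> - x \<notin> H"
    and d: "\<And>x. x \<in> S \<Longrightarrow> d (- x) = d x" "\<And>x. x \<in> S \<Longrightarrow> d (\<sigma> x) = d x"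
  shows "(\<Sum>i\<in>{i \<in> PiE S (\<lambda>x. {..<d x}). \<forall>x\<in>S. i (- x) = i (\<sigma> x)}. \<Prod>x\<in>H. g x (i x) (i (- x))) =
    (\<Sum>j\<in>PiE H (\<lambda>x. {..<d x}). \<Prod>x\<in>H. g x (j x) (j (\<sigma> x)))"
proof (rule sum.reindex_bij_witness[where
      i = "\<lambda>j. \<lambda>x\<in>S. if x \<in> H then j x else j (\<sigma> (- x))" and j = "\<lambda>i. restrict i H"])
  fix i assume "i \<in> {i \<in> PiE S (\<lambda>x. {..<d x}). \<forall>x\<in>S. i (- x) = i (\<sigma> x)}"
  then have i: "i \<in> PiE S (\<lambda>x. {..<d x})" and cond: "\<And>x. x \<in> S \<Longrightarrow> i (- x) = i (\<sigma> x)" by auto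
  show "(\<lambda>x\<in>S. if x \<in> H then restrict i H x else restrict i H (\<sigma> (- x))) = i"
  proof
    fix x show "(\<lambda>x\<in>S. if x \<in> H then restrict i H x else restrict i H (\<sigma> (- x))) x = i x"
    proof (cases "x \<in> S")
      case True
      have "restrict i H (\<sigma> (- x)) = i x" if "x \<notin> H"
        using that compl[OF True] step[of "- x"] cond[OF neg[OF True]] by simp
      then show ?thesis using True by simp
    next
      case False
      then show ?thesis using PiE_arb[OF i False] by simp
    qed
  qed
  show "restrict i H \<in> PiE H (\<lambda>x. {..<d x})" using i HS by auto
  show "(\<Prod>x\<in>H. g x (restrict i H x) (restrict i H (\<sigma> x))) = (\<Prod>x\<in>H. g x (i x) (i (- x)))"
    using cond HS step by (intro prod.cong refl) auto
next
  fix j assume j: "j \<in> PiE H (\<lambda>x. {..<d x})"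
  let ?i = "\<lambda>x\<in>S. if x \<in> H then j x else j (\<sigma> (- x))"
  have nstep: "\<sigma> x \<notin> H" if "x \<in> S" "x \<notin> H" for x
  proof
    assume "\<sigma> x \<in> H"
    have "\<sigma> ` H = H"
      using step HS fin bij_betw_imp_inj_on[OF bij_betw_self] inj_on_subset finite_subset
      by (intro endo_inj_surj) blast+
    then obtain y where "y \<in> H" "\<sigma> y = \<sigma> x" using \<open>\<sigma> x \<in> H\<close> by (metis imageE)
    then show False using that HS bij_betw_imp_inj_on[OF bij_betw_self] by (metis inj_onD subsetD)
  qed
  show "restrict ?i H = j"
  proof
    fix x show "restrict ?i H x = j x"
      using HS PiE_arb[OF j, of x] by (cases "x \<in> H") auto
  qed
  have "?i \<in> PiE S (\<lambda>x. {..<d x})"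
  proof (rule restrict_PiE_iff[THEN iffD2], rule ballI)
    fix x assume x: "x \<in> S"
    show "(if x \<in> H then j x else j (\<sigma> (- x))) \<in> {..<d x}"
    proof (cases "x \<in> H")
      case False
      then have "\<sigma> (- x) \<in> H" using compl[OF x] step by auto
      then have "j (\<sigma> (- x)) < d (\<sigma> (- x))" using PiE_mem[OF j] by auto
      then show ?thesis using False d x neg[OF x] by simp
    qed (use PiE_mem[OF j] in auto)
  qed
  moreover have "?i (- x) = ?i (\<sigma> x)" if x: "x \<in> S" for x
  proof (cases "x \<in> H")
    case True
    then show ?thesis using x neg[OF x] closed[OF x] compl[OF x] step by simp
  next
    case False
    then show ?thesis using x neg[OF x] closed[OF x] compl[OF x] nstep[OF x False] reverses[OF x] by simp
  qed
  ultimately show "?i \<in> {i \<in> PiE S (\<lambda>x. {..<d x}). \<forall>x\<in>S. i (- x) = i (\<sigma> x)}" by blast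
qed

end

section \<open>The sum over the indices matched by a pairing\<close>

text \<open>
  A signed position \<open>x\<close> stands for the matrix \<open>D x\<close> if \<open>x > 0\<close>, and for the transpose of \<open>D (- x)\<close> if
  \<open>x < 0\<close>. Its row index is coordinate \<open>odd x\<close> of \<open>e (slot_position \<gamma> x)\<close>, and its column index is the
  row index of \<open>- x\<close>. Conversely \<open>slot \<gamma> p c\<close> is the signed position whose row index is the
  coordinate \<open>c\<close> of \<open>e p\<close>, so that signed positions correspond to pairs of a position and a coordinate.
\<close>
definition slot :: "(nat \<Rightarrow> nat) \<Rightarrow> nat \<Rightarrow> bool \<Rightarrow> int" where
  "slot \<gamma> p c = (if odd p = c then int p else - int (inv_into UNIV \<gamma> p))"

definition slot_position :: "(nat \<Rightarrow> nat) \<Rightarrow> int \<Rightarrow> nat" where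
  "slot_position \<gamma> x = (if x > 0 then nat x else \<gamma> (nat (- x)))"

context
  fixes \<gamma> :: "nat \<Rightarrow> nat" and m :: nat
  assumes \<gamma>: "\<gamma> permutes {1..m}" and flip: "\<forall>p\<in>{1..m}. odd (\<gamma> p) \<longleftrightarrow> even p"
begin

lemma inv_gamma:
  assumes "p \<in> {1..m}"
  shows "inv_into UNIV \<gamma> p \<in> {1..m}" "\<gamma> (inv_into UNIV \<gamma> p) = p" "odd (inv_into UNIV \<gamma> p) \<longleftrightarrow> even p"
proof -
  show 1: "inv_into UNIV \<gamma> p \<in> {1..m}" using permutes_in_image[OF permutes_inv[OF \<gamma>]] assms by simp
  show 2: "\<gamma> (inv_into UNIV \<gamma> p) = p" using permutes_inverses(1)[OF \<gamma>] .
  show "odd (inv_into UNIV \<gamma> p) \<longleftrightarrow> even p" using bspec[OF flip 1] 2 by auto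
qed

lemma slot_facts:
  assumes "p \<in> {1..m}"
  shows "slot \<gamma> p c \<in> signed_interval m" "slot_position \<gamma> (slot \<gamma> p c) = p" "odd (slot \<gamma> p c) = c"
  using assms inv_gamma[OF assms] by (auto simp: slot_def slot_position_def signed_interval_def)

lemma slot_position_facts:
  assumes "x \<in> signed_interval m"
  shows "slot_position \<gamma> x \<in> {1..m}" "slot \<gamma> (slot_position \<gamma> x) (odd x) = x"
proof -
  have "slot_position \<gamma> x \<in> {1..m} \<and> slot \<gamma> (slot_position \<gamma> x) (odd x) = x"
  proof (cases "x > 0")
    case True
    then have "nat x \<in> {1..m}" "odd (nat x) \<longleftrightarrow> odd x"
      using assms by (auto simp: signed_interval_def even_nat_iff)
    then show ?thesis using True by (simp add: slot_position_def slot_def)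
  next
    case False
    define q where "q = nat (- x)"
    have q: "x = - int q" "q \<in> {1..m}" using False assms by (auto simp: q_def signed_interval_def)
    have "\<gamma> q \<in> {1..m}" using permutes_in_image[OF \<gamma>] q by simp
    moreover have "inv_into UNIV \<gamma> (\<gamma> q) = q" using permutes_inverses(2)[OF \<gamma>] .
    ultimately show ?thesis using bspec[OF flip q(2)] q(2) unfolding q(1) by (simp add: slot_position_def slot_def)
  qed
  then show "slot_position \<gamma> x \<in> {1..m}" "slot \<gamma> (slot_position \<gamma> x) (odd x) = x" by auto
qed

end

text \<open>
  The column index of \<open>x\<close> is a coordinate of \<open>e p\<close> with \<open>p = slot_position \<gamma> (- x)\<close>. The pairing identifies
  \<open>e p\<close> with \<open>e\<close> at the partner of \<open>p\<close>, and the permutation moves \<open>x\<close> to the signed position whose row index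
  is the same coordinate there: it is the walk from column index to row index.
\<close>
lemma gamma_hat_slot:
  fixes r ns \<pi>
  defines "m \<equiv> 2 * psum ns r"
  assumes \<pi>: "\<pi> \<in> pairings_on {1..m}" and x: "x \<in> signed_interval m"
  shows "gamma_hat r ns \<pi> x =
    slot (gamma r ns) (pairing_perm \<pi> (slot_position (gamma r ns) (- x))) (odd x)"
proof -
  let ?\<gamma> = "gamma r ns" and ?\<tau> = "pairing_perm \<pi>"
  have \<gamma>: "?\<gamma> permutes {1..m}" unfolding m_def by (rule gamma_permutes)
  have flip: "\<forall>p\<in>{1..m}. odd (?\<gamma> p) \<longleftrightarrow> even p"
    using gamma_label(2) unfolding m_def by blast
  define p where "p = slot_position ?\<gamma> (- x)"
  have p: "p \<in> {1..m}"
    unfolding p_def using x by (intro slot_position_facts(1)[OF \<gamma> flip]) (auto simp: signed_interval_def)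
  have \<tau>p: "?\<tau> p \<in> {1..m}" using pairing_perm_block(3)[OF \<pi> p] .
  have pos: "extend_pos ?\<tau> (int q) = int (?\<tau> q)" if "q \<in> {1..m}" for q
    using that by (simp add: extend_pos_def)
  have neg: "extend_pos ?\<tau> (- int q) = - int q" for q
    by (simp add: extend_pos_def)
  have hat_pos: "pi_hat \<pi> (int p) = (if odd p = odd (?\<tau> p) then - int (?\<tau> p) else int (?\<tau> p))"
    using p \<tau>p by (auto simp: pi_hat_def delta'_def delta_def pos neg)
  have hat_neg: "pi_hat \<pi> (- int p) = (if odd p = odd (?\<tau> p) then int (?\<tau> p) else - int (?\<tau> p))"
    using p \<tau>p by (auto simp: pi_hat_def delta'_def delta_def pos neg)
  have inv_pos: "inv_into UNIV (gamma_minus r ns) (int q) = int q" if "q \<in> {1..m}" for q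
    using that by (intro inv_f_eq inj_gamma_minus gamma_minus_nonneg) auto
  have inv_neg: "inv_into UNIV (gamma_minus r ns) (- int q) = - int (inv_into UNIV ?\<gamma> q)" if "q \<in> {1..m}" for q
    using inv_gamma(2)[OF \<gamma> flip that] by (intro inv_f_eq inj_gamma_minus) (simp add: gamma_minus_neg)
  show ?thesis
  proof (cases "x > 0")
    case True
    then have "nat x \<in> {1..m}" using x by (auto simp: signed_interval_def)
    then have "gamma_plus r ns x = int p" "odd p \<longleftrightarrow> even x"
      using True bspec[OF flip, of "nat x"] by (auto simp: p_def slot_position_def gamma_plus_def extend_pos_def signed_interval_def even_nat_iff)
    then show ?thesis
      using \<tau>p unfolding p_def[symmetric] by (auto simp: gamma_hat_def hat_pos inv_pos inv_neg slot_def)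
  next
    case False
    then have "gamma_plus r ns x = - int p" "odd p \<longleftrightarrow> odd x"
      using x by (auto simp: p_def slot_position_def gamma_plus_def extend_pos_def signed_interval_def even_nat_iff)
    then show ?thesis
      using \<tau>p unfolding p_def[symmetric] by (auto simp: gamma_hat_def hat_neg inv_pos inv_neg slot_def)
  qed
qed

text \<open>
  In terms of the row indices \<open>i x\<close>, the functions \<open>e\<close> constant on the blocks of \<open>\<pi>\<close> become the index
  functions with \<open>i (- x) = i (\<sigma> x)\<close>: the column index of \<open>x\<close> is the row index of the next matrix. Each
  entry of \<open>D\<close> may be read off at \<open>x\<close> or, transposed, at \<open>- x\<close>; reading it on the particular cycles
  gives the traces.
\<close>
lemma sum_matched_eq_Tr_perm:
  fixes r ns \<pi> and D :: "nat \<Rightarrow> real mat"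
  defines "m \<equiv> 2 * psum ns r"
  assumes \<pi>: "\<pi> \<in> pairings_on {1..m}"
    and D: "\<And>p. p \<in> {1..m} \<Longrightarrow> odd p \<Longrightarrow> D p \<in> carrier_mat M M"
      "\<And>p. p \<in> {1..m} \<Longrightarrow> even p \<Longrightarrow> D p \<in> carrier_mat N N"
  shows "(\<Sum>e\<in>PiE {1..m} (\<lambda>_. {..<M} \<times> {..<N}).
      (\<Prod>p\<in>{1..m}. D p $$ (coordinate (odd p) (e p), coordinate (odd p) (e (gamma r ns p)))) *
      (\<Prod>b\<in>\<pi>. matched e b)) =
    Tr_perm (half_domain (gamma_hat r ns \<pi>) (signed_interval m)) (half (gamma_hat r ns \<pi>) (signed_interval m)) D"
proof -
  let ?V = "{1..m}" and ?S = "signed_interval m"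
  let ?\<gamma> = "gamma r ns" and ?\<tau> = "pairing_perm \<pi>" and ?\<sigma> = "gamma_hat r ns \<pi>"
  define H where "H = half_domain ?\<sigma> ?S"
  define d :: "int \<Rightarrow> nat" where "d x = (if odd x then M else N)" for x
  have \<gamma>: "?\<gamma> permutes ?V" unfolding m_def by (rule gamma_permutes)
  have flip: "\<forall>p\<in>?V. odd (?\<gamma> p) \<longleftrightarrow> even p"
    using gamma_label(2) unfolding m_def by blast
  note slot = slot_facts[OF \<gamma> flip] and position = slot_position_facts[OF \<gamma> flip]
  note \<tau> = pairing_perm_block[OF \<pi>]
  have \<sigma>: "?\<sigma> x = slot ?\<gamma> (?\<tau> (slot_position ?\<gamma> (- x))) (odd x)" if "x \<in> ?S" for x
    using gamma_hat_slot[of \<pi> ns r x] \<pi> that unfolding m_def by blast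
  have S: "finite ?S" "0 \<notin> ?S" "\<And>x. x \<in> ?S \<Longrightarrow> - x \<in> ?S"
  proof -
    have "?S \<subseteq> {- int m..int m}" by (auto simp: signed_interval_def)
    then show "finite ?S" using finite_subset by blast
  qed (auto simp: signed_interval_def)
  have q: "?\<tau> (slot_position ?\<gamma> (- x)) \<in> ?V" if "x \<in> ?S" for x
    using that S(3) position(1) \<tau>(3) by blast
  have \<sigma>S: "?\<sigma> x \<in> ?S" "slot_position ?\<gamma> (?\<sigma> x) = ?\<tau> (slot_position ?\<gamma> (- x))" "odd (?\<sigma> x) = odd x"
    if "x \<in> ?S" for x
    using slot[OF q[OF that]] \<sigma>[OF that] by simp_all
  have rev: "?\<sigma> (- ?\<sigma> x) = - x" if "x \<in> ?S" for x
  proof -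
    have "?\<sigma> (- ?\<sigma> x) = slot ?\<gamma> (?\<tau> (?\<tau> (slot_position ?\<gamma> (- x)))) (odd x)"
      using \<sigma>[OF S(3)[OF \<sigma>S(1)[OF that]]] \<sigma>S(2,3)[OF that] by simp
    also have "\<dots> = slot ?\<gamma> (slot_position ?\<gamma> (- x)) (odd (- x))"
      using \<tau>(4)[OF position(1)[OF S(3)[OF that]]] by simp
    also have "\<dots> = - x" using position(2)[OF S(3)[OF that]] .
    finally show ?thesis .
  qed
  have nofix: "?\<sigma> x \<noteq> - x" if "x \<in> ?S" for x
    using \<sigma>S(2)[OF that] \<tau>(2)[OF position(1)[OF S(3)[OF that]]] by metis
  interpret \<sigma>: neg_reversing ?S ?\<sigma>
    by unfold_locales (fact S \<sigma>S(1) rev nofix)+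
  note half = \<sigma>.half_domain_step[folded H_def] \<sigma>.half_domain_complement[folded H_def]
  have HS: "H \<subseteq> ?S" by (auto simp: H_def half_domain_def)
  have Dcar: "signed_mat D x \<in> carrier_mat (d x) (d x)" if "x \<in> ?S" for x
  proof -
    have "nat \<bar>x\<bar> \<in> ?V" "even (nat \<bar>x\<bar>) \<longleftrightarrow> even x" using that by (auto simp: signed_interval_def even_nat_iff)
    then have "D (nat \<bar>x\<bar>) \<in> carrier_mat (d x) (d x)" using D[of "nat \<bar>x\<bar>"] by (auto simp: d_def)
    then show ?thesis by (auto simp: signed_mat_def)
  qed
  have "(\<Sum>e\<in>PiE ?V (\<lambda>_. {..<M} \<times> {..<N}).
        (\<Prod>p\<in>?V. D p $$ (coordinate (odd p) (e p), coordinate (odd p) (e (?\<gamma> p)))) * (\<Prod>b\<in>\<pi>. matched e b)) =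
      (\<Sum>e\<in>PiE ?V (\<lambda>_. {..<M} \<times> {..<N}). if \<forall>p\<in>?V. e (?\<tau> p) = e p
        then \<Prod>p\<in>?V. D p $$ (coordinate (odd p) (e p), coordinate (odd p) (e (?\<gamma> p))) else 0)"
    by (intro sum.cong refl) (auto simp: prod_matched[OF \<pi>])
  also have "\<dots> = (\<Sum>e\<in>{e \<in> PiE ?V (\<lambda>_. {..<M} \<times> {..<N}). \<forall>p\<in>?V. e (?\<tau> p) = e p}.
      \<Prod>p\<in>?V. D p $$ (coordinate (odd p) (e p), coordinate (odd p) (e (?\<gamma> p))))"
    by (intro sum.inter_filter[symmetric] finite_PiE) auto
  also have "\<dots> = (\<Sum>i\<in>{i \<in> PiE ?S (\<lambda>x. {..<d x}). \<forall>x\<in>?S. i (- x) = i (?\<sigma> x)}.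
      \<Prod>x\<in>H. signed_mat D x $$ (i x, i (- x)))"
  proof (rule sum.reindex_bij_witness[where
        j = "\<lambda>e. \<lambda>x\<in>?S. coordinate (odd x) (e (slot_position ?\<gamma> x))" and
        i = "\<lambda>i. \<lambda>p\<in>?V. (i (slot ?\<gamma> p True), i (slot ?\<gamma> p False))"])
    fix e assume "e \<in> {e \<in> PiE ?V (\<lambda>_. {..<M} \<times> {..<N}). \<forall>p\<in>?V. e (?\<tau> p) = e p}"
    then have e: "e \<in> PiE ?V (\<lambda>_. {..<M} \<times> {..<N})" and inv: "\<And>p. p \<in> ?V \<Longrightarrow> e (?\<tau> p) = e p" by auto
    let ?i = "\<lambda>x\<in>?S. coordinate (odd x) (e (slot_position ?\<gamma> x))"
    show "(\<lambda>p\<in>?V. (?i (slot ?\<gamma> p True), ?i (slot ?\<gamma> p False))) = e"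
    proof
      fix p show "(\<lambda>p\<in>?V. (?i (slot ?\<gamma> p True), ?i (slot ?\<gamma> p False))) p = e p"
      proof (cases "p \<in> ?V")
        case True
        then show ?thesis using slot[OF True] by (simp add: coordinate_def)
      next
        case False
        then show ?thesis using PiE_arb[OF e False] by (simp only: restrict_apply if_False)
      qed
    qed
    have bound: "?i x < d x" if "x \<in> ?S" for x
      using PiE_mem[OF e position(1)[OF that]] that by (auto simp: coordinate_def d_def mem_Times_iff)
    then have "?i \<in> PiE ?S (\<lambda>x. {..<d x})" by auto
    moreover have "?i (- x) = ?i (?\<sigma> x)" if "x \<in> ?S" for x
      using that S(3)[OF that] \<sigma>S[OF that] inv[OF position(1)[OF S(3)[OF that]]] by simp
    ultimately show "?i \<in> {i \<in> PiE ?S (\<lambda>x. {..<d x}). \<forall>x\<in>?S. i (- x) = i (?\<sigma> x)}" by blast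
    have entry: "signed_mat D x $$ (?i x, ?i (- x)) =
        D (nat \<bar>x\<bar>) $$ (coordinate (odd (nat \<bar>x\<bar>)) (e (nat \<bar>x\<bar>)), coordinate (odd (nat \<bar>x\<bar>)) (e (?\<gamma> (nat \<bar>x\<bar>))))"
      if x: "x \<in> ?S" for x
    proof (cases "x > 0")
      case True
      then show ?thesis
        using x S(3)[OF x] by (simp add: signed_mat_def slot_position_def even_nat_iff)
    next
      case False
      then have "x < 0" using x S(2) by (cases "x = 0") auto
      then have "D (nat (- x)) \<in> carrier_mat (d x) (d x)" using Dcar[OF S(3)[OF x]] by (simp add: signed_mat_def d_def)
      moreover have "?i x < d x" "?i (- x) < d x" using bound[OF x] bound[OF S(3)[OF x]] by (auto simp: d_def)
      ultimately have "signed_mat D x $$ (?i x, ?i (- x)) = D (nat (- x)) $$ (?i (- x), ?i x)"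
        using \<open>x < 0\<close> by (simp add: signed_mat_def)
      then show ?thesis
        using \<open>x < 0\<close> x S(3)[OF x] by (simp add: slot_position_def even_nat_iff)
    qed
    have "bij_betw (\<lambda>x. nat \<bar>x\<bar>) H ?V"
    proof (rule bij_betw_imageI)
      show "inj_on (\<lambda>x. nat \<bar>x\<bar>) H"
      proof (rule inj_onI)
        fix x y assume xy: "x \<in> H" "y \<in> H" "nat \<bar>x\<bar> = nat \<bar>y\<bar>"
        then have "y = x \<or> y = - x" by linarith
        then show "x = y" using half(2)[of x] HS xy(1,2) by blast
      qed
      show "(\<lambda>x. nat \<bar>x\<bar>) ` H = ?V"
      proof (intro equalityI subsetI)
        fix p assume p: "p \<in> ?V"
        then have "int p \<in> ?S" by (auto simp: signed_interval_def)
        then have "int p \<in> H \<or> - int p \<in> H" using half(2) by blast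
        then show "p \<in> (\<lambda>x. nat \<bar>x\<bar>) ` H" by force
      qed (use HS in \<open>auto simp: signed_interval_def\<close>)
    qed
    then have reindex: "(\<Prod>x\<in>H. D (nat \<bar>x\<bar>) $$ (coordinate (odd (nat \<bar>x\<bar>)) (e (nat \<bar>x\<bar>)), coordinate (odd (nat \<bar>x\<bar>)) (e (?\<gamma> (nat \<bar>x\<bar>))))) =
        (\<Prod>p\<in>?V. D p $$ (coordinate (odd p) (e p), coordinate (odd p) (e (?\<gamma> p))))"
      by (rule prod.reindex_bij_betw)
    show "(\<Prod>x\<in>H. signed_mat D x $$ (?i x, ?i (- x))) =
        (\<Prod>p\<in>?V. D p $$ (coordinate (odd p) (e p), coordinate (odd p) (e (?\<gamma> p))))"
      unfolding reindex[symmetric] by (rule prod.cong[OF refl], rule entry, rule subsetD[OF HS])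
  next
    fix i assume "i \<in> {i \<in> PiE ?S (\<lambda>x. {..<d x}). \<forall>x\<in>?S. i (- x) = i (?\<sigma> x)}"
    then have i: "i \<in> PiE ?S (\<lambda>x. {..<d x})" and cond: "\<And>x. x \<in> ?S \<Longrightarrow> i (- x) = i (?\<sigma> x)" by auto
    let ?e = "\<lambda>p\<in>?V. (i (slot ?\<gamma> p True), i (slot ?\<gamma> p False))"
    have e_coord: "coordinate c (?e p) = i (slot ?\<gamma> p c)" if "p \<in> ?V" for p c
      using that by (cases c) (auto simp: coordinate_def)
    show "(\<lambda>x\<in>?S. coordinate (odd x) (?e (slot_position ?\<gamma> x))) = i"
    proof
      fix x show "(\<lambda>x\<in>?S. coordinate (odd x) (?e (slot_position ?\<gamma> x))) x = i x"
      proof (cases "x \<in> ?S")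
        case True
        then show ?thesis
          unfolding restrict_apply[of _ ?S] if_P[OF True] e_coord[OF position(1)[OF True]] position(2)[OF True] by simp
      next
        case False
        then show ?thesis using PiE_arb[OF i False] by (simp only: restrict_apply if_False)
      qed
    qed
    have slotb: "i (slot ?\<gamma> p c) < (if c then M else N)" if "p \<in> ?V" for p c
      using PiE_mem[OF i slot(1)[OF that, of c]] slot(3)[OF that, of c] by (simp add: d_def)
    then have "?e \<in> PiE ?V (\<lambda>_. {..<M} \<times> {..<N})"
      using slotb[of _ True] slotb[of _ False] by auto
    moreover have "?e (?\<tau> p) = ?e p" if p: "p \<in> ?V" for p
    proof -
      have "i (slot ?\<gamma> (?\<tau> p) c) = i (slot ?\<gamma> p c)" for c
      proof -
        let ?x = "- slot ?\<gamma> p c"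
        have x: "?x \<in> ?S" using S(3) slot(1)[OF p] by blast
        have "?\<sigma> ?x = slot ?\<gamma> (?\<tau> p) c" using \<sigma>[OF x] slot(2,3)[OF p, of c] by simp
        then show ?thesis using cond[OF x] by simp
      qed
      then show ?thesis using p \<tau>(3)[OF p] by simp
    qed
    ultimately show "?e \<in> {e \<in> PiE ?V (\<lambda>_. {..<M} \<times> {..<N}). \<forall>p\<in>?V. e (?\<tau> p) = e p}" by blast
  qed
  also have "\<dots> = (\<Sum>j\<in>PiE H (\<lambda>x. {..<d x}). \<Prod>x\<in>H. signed_mat D x $$ (j x, j (?\<sigma> x)))"
    using half \<sigma>S(3) by (intro \<sigma>.sum_over_half[where g = "\<lambda>x u v. signed_mat D x $$ (u, v)"] HS) (auto simp: d_def)
  also have "\<dots> = (\<Sum>j\<in>PiE H (\<lambda>x. {..<d x}). \<Prod>x\<in>H. signed_mat D x $$ (j x, j (half ?\<sigma> ?S x)))"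
    by (intro sum.cong prod.cong refl) (auto simp: half_def H_def perm_restrict_def)
  also have "\<dots> = Tr_perm H (half ?\<sigma> ?S) D"
  proof (rule Tr_perm_eq_sum[symmetric])
    show finH: "finite H" using HS S(1) finite_subset by blast
    have onH: "half ?\<sigma> ?S x = ?\<sigma> x" if "x \<in> H" for x using that by (simp add: half_def H_def perm_restrict_def)
    have "inj_on ?\<sigma> H" using bij_betw_imp_inj_on[OF \<sigma>.bij_betw_self] HS inj_on_subset by blast
    moreover have "?\<sigma> ` H \<subseteq> H" using half(1) by blast
    ultimately have "bij_betw ?\<sigma> H H" using finH by (simp add: bij_betw_def endo_inj_surj)
    then have "bij_betw (half ?\<sigma> ?S) H H" using onH by (simp cong: bij_betw_cong)
    then show "half ?\<sigma> ?S permutes H"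
      by (rule bij_imp_permutes) (simp add: half_def H_def perm_restrict_def)
    show "signed_mat D x \<in> carrier_mat (d x) (d x)" if "x \<in> H" for x using Dcar HS that by blast
    show "d (half ?\<sigma> ?S x) = d x" if "x \<in> H" for x using \<sigma>S(3) HS that onH[OF that] by (auto simp: d_def)
  qed
  finally show ?thesis unfolding H_def .
qed

section \<open>The cumulants of \<open>Y\<^sub>1, \<dots>, Y\<^sub>r\<close>\<close>

theorem proposition5p5:
  fixes r M N n :: nat
    and ns :: "nat \<Rightarrow> nat"
    and P :: "'a measure"
    and f :: "nat \<Rightarrow> nat \<Rightarrow> 'a \<Rightarrow> real"
    and D :: "nat \<Rightarrow> real mat"
  assumes "r > 0" "M > 0" "N > 0"
    and "\<And>k. k \<in> {1..r} \<Longrightarrow> ns k > 0"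
    and "n = (\<Sum>k=1..r. ns k)"
    and "prob_space P"
    and "prob_space.indep_vars P (\<lambda>_. borel) (\<lambda>(i, j). f i j) ({..<M} \<times> {..<N})"
    and "\<And>i j. i < M \<Longrightarrow> j < N \<Longrightarrow> distributed P lborel (f i j) std_normal_density"
    and "\<And>m. m \<in> {1..2 * n} \<Longrightarrow> odd m \<Longrightarrow> D m \<in> carrier_mat M M"
    and "\<And>m. m \<in> {1..2 * n} \<Longrightarrow> even m \<Longrightarrow> D m \<in> carrier_mat N N"
  shows "cumulant P (Y M N f ns D) {1..r} =
    real N powi (- int n - int r) *
    (\<Sum>\<pi> | \<pi> \<in> pairings (2 * n) \<and>
        acts_transitively_on (generate (sym_group (2 * n)) {gamma r ns, pairing_perm \<pi>}) {1..2 * n}.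
      Tr_perm (half_domain (gamma_hat r ns \<pi>) (signed_interval (2 * n)))
              (half (gamma_hat r ns \<pi>) (signed_interval (2 * n))) D)"
proof -
  interpret prob_space P by fact
  let ?V = "{1..2 * n}" and ?L = "interval_label ns" and ?C = "{..<M} \<times> {..<N}"
  define entry where "entry e p = D p $$ (coordinate (odd p) (e p), coordinate (odd p) (e (gamma r ns p)))" for e p
  define coef where "coef k e = (\<Prod>p\<in>?V \<inter> ?L -` {k}. entry e p) / real N ^ (ns k + 1)" for k e
  define T where "T \<pi> = Tr_perm (half_domain (gamma_hat r ns \<pi>) (signed_interval (2 * n)))
    (half (gamma_hat r ns \<pi>) (signed_interval (2 * n))) D" for \<pi>
  have n: "psum ns r = n" using assms(5) by (simp add: psum_def)
  have label: "?L p \<in> {1..r}" if "p \<in> ?V" for p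
    using interval_label_bounds(1)[of p ns r] that unfolding n by blast
  have gamma: "gamma r ns p \<in> ?V" "?L (gamma r ns p) = ?L p" if "p \<in> ?V" for p
    using permutes_in_image[OF gamma_permutes[of r ns], of p] gamma_label(1)[of p ns r] that unfolding n by auto
  have V: "?V \<inter> ?L -` {1..r} = ?V" "?V = (\<Union>k\<in>{1..r}. ?V \<inter> ?L -` {k})"
    using label by auto
  have image: "?L ` ?V = {1..r}"
  proof (intro equalityI subsetI)
    fix k assume k: "k \<in> {1..r}"
    have "2 * psum ns k \<in> {2 * psum ns (k - 1) + 1..2 * psum ns k}"
      using psum_rec[of k ns] k assms(4)[OF k] by auto
    then have "2 * psum ns k \<in> ?V \<inter> ?L -` {k}"
      using interval_label_fibre[OF k, of ns] unfolding n by blast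
    then show "k \<in> ?L ` ?V" by (intro image_eqI[where x = "2 * psum ns k"]) auto
  qed (use label in blast)
  have coef_all: "(\<Prod>k\<in>{1..r}. coef k e) = (\<Prod>p\<in>?V. entry e p) / real N ^ (n + r)" for e
  proof -
    have "(\<Prod>p\<in>?V. entry e p) = (\<Prod>k\<in>{1..r}. \<Prod>p\<in>?V \<inter> ?L -` {k}. entry e p)"
      by (subst V(2), rule prod.UNION_disjoint) auto
    moreover have "(\<Prod>k\<in>{1..r}. real N ^ (ns k + 1)) = real N ^ (n + r)"
    proof -
      have "(\<Sum>k=1..r. ns k + 1) = n + r" unfolding sum.distrib assms(5) by simp
      then show ?thesis unfolding power_sum[symmetric] by simp
    qed
    ultimately show ?thesis by (simp add: coef_def prod_dividef)
  qed
  have "cumulant P (Y M N f ns D) {1..r} = (\<Sum>\<pi>\<in>connected_pairings ?V ?L {1..r}.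
      \<Sum>e\<in>PiE (?V \<inter> ?L -` {1..r}) (\<lambda>_. ?C). (\<Prod>k\<in>{1..r}. coef k e) * (\<Prod>b\<in>\<pi>. matched e b))"
  proof (rule cumulant_gaussian_forms[where F = "\<lambda>(i, j). f i j"])
    show "Y M N f ns D k \<omega> = (\<Sum>e\<in>PiE (?V \<inter> ?L -` {k}) (\<lambda>_. ?C).
        coef k e * (\<Prod>p\<in>?V \<inter> ?L -` {k}. (case e p of (i, j) \<Rightarrow> f i j) \<omega>))" if "k \<in> {1..r}" for k \<omega>
      unfolding coef_def entry_def
      by (rule Y_expansion[of N k r ns D M f \<omega>, unfolded n]) (use assms(3,4,9,10) that in blast)+
    show "coef k (restrict e (?V \<inter> ?L -` {k})) = coef k e" if "k \<in> {1..r}" for k e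
      using gamma unfolding coef_def entry_def by (intro arg_cong2[where f = "(/)"] prod.cong refl) auto
  qed (use assms in auto)
  also have "\<dots> = (\<Sum>\<pi>\<in>connected_pairings ?V ?L {1..r}. T \<pi> / real N ^ (n + r))"
  proof (rule sum.cong[OF refl])
    fix \<pi> assume "\<pi> \<in> connected_pairings ?V ?L {1..r}"
    then have "\<pi> \<in> pairings_on ?V" unfolding connected_pairings_def V(1) by simp
    then have "(\<Sum>e\<in>PiE ?V (\<lambda>_. ?C). (\<Prod>p\<in>?V. entry e p) * (\<Prod>b\<in>\<pi>. matched e b)) = T \<pi>"
      using sum_matched_eq_Tr_perm[of \<pi> ns r D M N] assms(9,10) unfolding n T_def entry_def by blast
    then show "(\<Sum>e\<in>PiE (?V \<inter> ?L -` {1..r}) (\<lambda>_. ?C). (\<Prod>k\<in>{1..r}. coef k e) * (\<Prod>b\<in>\<pi>. matched e b)) =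
        T \<pi> / real N ^ (n + r)"
      unfolding V(1) coef_all by (simp flip: sum_divide_distrib)
  qed
  also have "connected_pairings ?V ?L {1..r} = {\<pi>. \<pi> \<in> pairings (2 * n) \<and>
      acts_transitively_on (generate (sym_group (2 * n)) {gamma r ns, pairing_perm \<pi>}) ?V}"
  proof -
    have "acts_transitively_on (generate (sym_group (2 * n)) {gamma r ns, pairing_perm \<pi>}) ?V \<longleftrightarrow>
        connected_via ?L \<pi> {1..r}" if "\<pi> \<in> pairings_on ?V" for \<pi>
      unfolding image[symmetric]
    proof (rule transitive_iff_connected_via)
      show "gamma r ns permutes ?V" using gamma_permutes[of r ns] unfolding n .
      show "\<exists>i. (gamma r ns ^^ i) p = q" if "p \<in> ?V" "q \<in> ?V" "?L p = ?L q" for p q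
        using gamma_reaches[of p ns r q] that unfolding n by blast
    qed (use gamma that in auto)
    then show ?thesis unfolding connected_pairings_def V(1) by (auto simp: pairings_def pairings_on_def)
  qed
  also have "(\<Sum>\<pi> | \<pi> \<in> pairings (2 * n) \<and>
        acts_transitively_on (generate (sym_group (2 * n)) {gamma r ns, pairing_perm \<pi>}) ?V. T \<pi> / real N ^ (n + r)) =
      real N powi (- int n - int r) * (\<Sum>\<pi> | \<pi> \<in> pairings (2 * n) \<and>
        acts_transitively_on (generate (sym_group (2 * n)) {gamma r ns, pairing_perm \<pi>}) ?V. T \<pi>)"
  proof -
    have "- int n - int r = - int (n + r)" by simp
    then have "real N powi (- int n - int r) = inverse (real N ^ (n + r))"
      by (simp only: power_int_minus power_int_of_nat)
    then show ?thesis by (simp only: inverse_eq_divide sum_distrib_left) simp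
  qed
  finally show ?thesis unfolding T_def .
qed

end
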